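(* Let $G$ and $G'$ be connected graphs with the same degree sequence and the same set of external edges. Then: (a) $G$ can be transformed into $G'$ through a series of NNI moves. (b) One can choose a spanning tree in $G$ and a spanning tree in $G'$ and require that all the pivots of the NNI moves are internal edges of both of these spanning trees.
   Context: A graph $G=(V,E)$ consists of a finite vertex set $V$, a finite edge set $E$ disjoint from $V$, and an incidence function assigning to each edge an unordered pair of (not necessarily distinct) vertices, its ends; loops and parallel edges are allowed, and a loop contributes 2 to the degree. The degree sequence of $G$ is the monotonic nonincreasing sequence of the degrees of its vertices. A leaf is a vertex of degree one in a graph. An edge is external if it is incident to a leaf, and internal otherwise. NNI move (nearest neighbor interchange): let $W$ be a trail of length three in a graph, i.e. a walk $x,a,u,e,v,b,y$ with $a,e,b$ pairwise distinct edges, where $a$ has ends $x,u$, $e$ has ends $u,v$, and $b$ has ends $v,y$ (vertices may coincide). The NNI move on $W$ produces the graph with the same vertex set and edge set and the same incidence function except that now $a$ has ends $x,v$ and $b$ has ends $u,y$. The central edge $e$ is the pivot of the move. NNI moves preserve the degree sequence, the number of connected components, and the partition of the edge set into external and internal edges. "$G$ can be transformed into $G'$ through a series of NNI moves" means: there is a finite sequence of graphs starting at $G$, each obtained from the previous one by an NNI move, and ending at $G'$ (up to an isomorphism that fixes every external edge). *)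

theory Defs
  imports "HOL-Library.Uprod" "HOL-Library.Multiset"
begin

(* The incidence function is total on the type 'e; only its values on edges G matter.
   Vertices and edges live in separate types, so they are disjoint by construction. *)
record ('v, 'e) mgraph =
  verts :: "'v set"
  edges :: "'e set"
  ends :: "'e \<Rightarrow> 'v uprod"

definition mgraph :: "('v, 'e) mgraph \<Rightarrow> bool" where
  "mgraph G \<longleftrightarrow> finite (verts G) \<and> finite (edges G) \<and>
     (\<forall>e\<in>edges G. set_uprod (ends G e) \<subseteq> verts G)"

(* A loop at v is counted in both summands, hence contributes 2. *)
definition degree :: "('v, 'e) mgraph \<Rightarrow> 'v \<Rightarrow> nat" where
  "degree G v = card {e \<in> edges G. v \<in> set_uprod (ends G e)}
     + card {e \<in> edges G. ends G e = Upair v v}"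

definition degree_sequence :: "('v, 'e) mgraph \<Rightarrow> nat list" where
  "degree_sequence G =
     rev (sorted_list_of_multiset (image_mset (degree G) (mset_set (verts G))))"

definition leaf :: "('v, 'e) mgraph \<Rightarrow> 'v \<Rightarrow> bool" where
  "leaf G v \<longleftrightarrow> v \<in> verts G \<and> degree G v = 1"

definition external_edges :: "('v, 'e) mgraph \<Rightarrow> 'e set" where
  "external_edges G = {e \<in> edges G. \<exists>v\<in>set_uprod (ends G e). leaf G v}"

definition internal_edges :: "('v, 'e) mgraph \<Rightarrow> 'e set" where
  "internal_edges G = edges G - external_edges G"

(* The walk u, e1, v1, e2, v2, ..., ek, vk from u to v = vk is represented by its start u,
   the list of steps [(e1, v1), ..., (ek, vk)] and its last vertex v. *)
fun walk :: "('v, 'e) mgraph \<Rightarrow> 'v \<Rightarrow> ('e \<times> 'v) list \<Rightarrow> 'v \<Rightarrow> bool" where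
  "walk G u [] v \<longleftrightarrow> u \<in> verts G \<and> u = v"
| "walk G u ((e, w) # p) v \<longleftrightarrow> e \<in> edges G \<and> ends G e = Upair u w \<and> walk G w p v"

definition trail :: "('v, 'e) mgraph \<Rightarrow> 'v \<Rightarrow> ('e \<times> 'v) list \<Rightarrow> 'v \<Rightarrow> bool" where
  "trail G u p v \<longleftrightarrow> walk G u p v \<and> distinct (map fst p)"

definition connected_mgraph :: "('v, 'e) mgraph \<Rightarrow> bool" where
  "connected_mgraph G \<longleftrightarrow> verts G \<noteq> {} \<and>
     (\<forall>u\<in>verts G. \<forall>v\<in>verts G. \<exists>p. walk G u p v)"

(* Loops (length 1) and pairs of parallel edges (length 2) are cycles. *)
definition cycle :: "('v, 'e) mgraph \<Rightarrow> 'v \<Rightarrow> ('e \<times> 'v) list \<Rightarrow> bool" where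
  "cycle G u p \<longleftrightarrow> p \<noteq> [] \<and> trail G u p u \<and> distinct (map snd p)"

definition tree :: "('v, 'e) mgraph \<Rightarrow> bool" where
  "tree G \<longleftrightarrow> mgraph G \<and> connected_mgraph G \<and> (\<nexists>u p. cycle G u p)"

(* A spanning tree is given by its set of edges. *)
definition spanning_tree :: "('v, 'e) mgraph \<Rightarrow> 'e set \<Rightarrow> bool" where
  "spanning_tree G T \<longleftrightarrow> T \<subseteq> edges G \<and> tree (G\<lparr>edges := T\<rparr>)"

definition nni_move :: "('v, 'e) mgraph \<Rightarrow> 'e \<Rightarrow> ('v, 'e) mgraph \<Rightarrow> bool" where
  "nni_move G e H \<longleftrightarrow> (\<exists>x a u v b y. trail G x [(a, u), (e, v), (b, y)] y \<and>
     H = G\<lparr>ends := (ends G)(a := Upair x v, b := Upair u y)\<rparr>)"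

(* nni_series G es H: a series of moves from G to H whose successive pivots are es. *)
inductive nni_series :: "('v, 'e) mgraph \<Rightarrow> 'e list \<Rightarrow> ('v, 'e) mgraph \<Rightarrow> bool" where
  nni_refl: "nni_series G [] G"
| nni_step: "nni_move G e H \<Longrightarrow> nni_series H es K \<Longrightarrow> nni_series G (e # es) K"

definition mgraph_iso ::
  "('v, 'e) mgraph \<Rightarrow> ('w, 'f) mgraph \<Rightarrow> ('v \<Rightarrow> 'w) \<Rightarrow> ('e \<Rightarrow> 'f) \<Rightarrow> bool" where
  "mgraph_iso G H f g \<longleftrightarrow> bij_betw f (verts G) (verts H) \<and> bij_betw g (edges G) (edges H) \<and>
     (\<forall>e\<in>edges G. ends H (g e) = map_uprod f (ends G e))"

definition mgraph_iso_fixing_external ::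
  "('v, 'e) mgraph \<Rightarrow> ('w, 'e) mgraph \<Rightarrow> ('v \<Rightarrow> 'w) \<Rightarrow> ('e \<Rightarrow> 'e) \<Rightarrow> bool" where
  "mgraph_iso_fixing_external G H f g \<longleftrightarrow>
     mgraph_iso G H f g \<and> (\<forall>e\<in>external_edges G. g e = e)"

end

theory Submission
  imports Defs "HOL-Combinatorics.Permutations"
begin

text \<open>
A multigraph is a map \<open>h\<close> that attaches half-edges to vertices. In these terms an NNI move with
pivot \<open>e\<close> exchanges a half-edge at one end of \<open>e\<close> with a half-edge at the other end. Contracting
\<open>e\<close> hides the exchange, so every edge set that contains \<open>e\<close> and is a spanning tree stays a
spanning tree. This suggests fixing a spanning tree, moving only along its internal edges, and
regarding all other half-edges at the internal vertices as dangling. What has to be transformed is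
then a tree on the internal vertices that carries labelled dangling half-edges.

The essential observation (\<open>capture_along_path\<close>, \<open>capture_set\<close>) is that a vertex \<open>v\<close> can collect any
set \<open>S\<close> of fewer than \<open>deg v\<close> dangling half-edges. Follow the tree path from \<open>v\<close> to a member of \<open>S\<close>
that is still missing. Across the first edge of the path, \<open>v\<close> gives away a half-edge outside \<open>S\<close> and
receives the next half-edge of the path, which brings it one step closer; in the last step it
receives the missing half-edge itself. A half-edge to give away always exists, because \<open>S\<close> is too
small to occupy all the other places at \<open>v\<close>.

Now let two trees on the same vertices have the same degrees and the same dangling half-edges
(\<open>tree_rearrangement\<close>). Pick a leaf \<open>v\<close> of the target tree. In the source tree \<open>v\<close> collects the
dangling half-edges that it carries in the target; a single place at \<open>v\<close> is left, so \<open>v\<close> is a leaf of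
the source tree as well. Up to a relabelling of the tree edges, the tree edge at \<open>v\<close> is the same
one in both trees; delete \<open>v\<close>, let the other half of that edge dangle, and proceed by induction. Moves
are made in the source only and never have to be reversed.

For two graphs with the same degree sequence and the same external edges it remains to identify
their vertices and edges so that this applies
(\<open>leaf_compatible_vertex_bijection\<close>, \<open>edge_bijection_fixing\<close>, \<open>nni_transformation_along_trees\<close>):
vertices are matched by degree, leaves through their external edges, internal tree edges with
internal tree edges, and the remaining internal edges among themselves.
\<close>

text \<open>Half-edges are treated as indivisible points; quantifiers over them should not be split into
an edge and a Boolean.\<close>

declare split_paired_All [simp del] split_paired_Ex [simp del]

section \<open>Half-edges and exchanges across a pivot\<close>

definition mate :: "'e \<times> bool \<Rightarrow> 'e \<times> bool" where
  "mate \<alpha> = (fst \<alpha>, \<not> snd \<alpha>)"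

lemma mate_simps [simp]: "mate (mate \<alpha>) = \<alpha>" "fst (mate \<alpha>) = fst \<alpha>" "mate \<alpha> \<noteq> \<alpha>" "\<alpha> \<noteq> mate \<alpha>"
  by (auto simp: mate_def prod_eq_iff)

lemma fst_eq_iff_mate: "fst \<alpha> = fst \<beta> \<longleftrightarrow> \<alpha> = \<beta> \<or> \<alpha> = mate \<beta>"
  by (auto simp: mate_def prod_eq_iff)

text \<open>The half-edge \<open>\<epsilon>\<close> orients the pivot from the end of \<open>\<alpha>\<close> to the end of \<open>\<beta>\<close>. The two
half-edges may be the halves of one edge parallel to the pivot; this case is not an NNI move but
leaves the graph unchanged.\<close>

definition exchange :: "'e set \<Rightarrow> 'e set \<Rightarrow> ('e \<times> bool \<Rightarrow> 'v) \<Rightarrow> ('e \<times> bool \<Rightarrow> 'v) \<Rightarrow> bool" where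
  "exchange E P h h' \<longleftrightarrow> (\<exists>\<epsilon> \<alpha> \<beta>. fst \<epsilon> \<in> P \<and> fst \<alpha> \<in> E - {fst \<epsilon>} \<and> fst \<beta> \<in> E - {fst \<epsilon>} \<and>
     h \<alpha> = h \<epsilon> \<and> h \<beta> = h (mate \<epsilon>) \<and> h' = h \<circ> transpose \<alpha> \<beta>)"

text \<open>Counting half-edges instead of edges makes a loop contribute 2.\<close>

definition deg :: "'e set \<Rightarrow> ('e \<times> bool \<Rightarrow> 'v) \<Rightarrow> 'v \<Rightarrow> nat" where
  "deg E h v = card {\<alpha>. fst \<alpha> \<in> E \<and> h \<alpha> = v}"

lemma exchanges_mono:
  assumes "(exchange E Q)\<^sup>*\<^sup>* h h'" "Q \<subseteq> P"
  shows "(exchange E P)\<^sup>*\<^sup>* h h'"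
proof -
  have "exchange E Q \<le> exchange E P" using assms(2) unfolding exchange_def by blast
  then show ?thesis using assms(1) rtranclp_mono by blast
qed

lemma finite_half_edges: "finite E \<Longrightarrow> finite {\<alpha> :: 'e \<times> bool. fst \<alpha> \<in> E \<and> Q \<alpha>}"
  by (rule finite_subset[of _ "E \<times> UNIV"]) auto

lemma deg_transport:
  assumes \<rho>: "bij_betw \<rho> {\<alpha>. fst \<alpha> \<in> D} {\<alpha>. fst \<alpha> \<in> E}"
    and f: "inj_on f V" "\<And>\<alpha>. fst \<alpha> \<in> E \<Longrightarrow> h \<alpha> \<in> V" "v \<in> V"
  shows "deg D (f \<circ> h \<circ> \<rho>) (f v) = deg E h v"
proof -
  have \<rho>E: "fst (\<rho> \<alpha>) \<in> E" if "fst \<alpha> \<in> D" for \<alpha> using bij_betwE[OF \<rho>] that by auto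
  have "bij_betw \<rho> {\<alpha>. fst \<alpha> \<in> D \<and> (f \<circ> h \<circ> \<rho>) \<alpha> = f v} {\<alpha>. fst \<alpha> \<in> E \<and> h \<alpha> = v}"
  proof (rule bij_betw_imageI)
    show "inj_on \<rho> {\<alpha>. fst \<alpha> \<in> D \<and> (f \<circ> h \<circ> \<rho>) \<alpha> = f v}"
      using bij_betw_imp_inj_on[OF \<rho>] by (rule inj_on_subset) auto
    show "\<rho> ` {\<alpha>. fst \<alpha> \<in> D \<and> (f \<circ> h \<circ> \<rho>) \<alpha> = f v} = {\<alpha>. fst \<alpha> \<in> E \<and> h \<alpha> = v}"
    proof (intro equalityI subsetI)
      fix \<beta> assume "\<beta> \<in> {\<alpha>. fst \<alpha> \<in> E \<and> h \<alpha> = v}"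
      moreover from this obtain \<alpha> where "fst \<alpha> \<in> D" "\<beta> = \<rho> \<alpha>"
        using bij_betw_imp_surj_on[OF \<rho>] by blast
      ultimately show "\<beta> \<in> \<rho> ` {\<alpha>. fst \<alpha> \<in> D \<and> (f \<circ> h \<circ> \<rho>) \<alpha> = f v}" by auto
    next
      fix \<beta> assume "\<beta> \<in> \<rho> ` {\<alpha>. fst \<alpha> \<in> D \<and> (f \<circ> h \<circ> \<rho>) \<alpha> = f v}"
      then obtain \<alpha> where \<alpha>: "fst \<alpha> \<in> D" "f (h (\<rho> \<alpha>)) = f v" "\<beta> = \<rho> \<alpha>" by auto
      then have "h (\<rho> \<alpha>) = v" using inj_onD[OF f(1)] f(2,3) \<rho>E by blast
      then show "\<beta> \<in> {\<alpha>. fst \<alpha> \<in> E \<and> h \<alpha> = v}" using \<alpha> \<rho>E by simp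
    qed
  qed
  then show ?thesis unfolding deg_def by (rule bij_betw_same_card)
qed

lemma deg_permute: "\<rho> permutes {\<alpha>. fst \<alpha> \<in> E} \<Longrightarrow> deg E (h \<circ> \<rho>) v = deg E h v"
  using deg_transport[of \<rho> E E id UNIV h v] by (simp add: permutes_imp_bij)

lemma handshake:
  assumes "finite E" "finite V" "\<And>\<alpha>. fst \<alpha> \<in> E \<Longrightarrow> h \<alpha> \<in> V"
  shows "(\<Sum>v\<in>V. deg E h v) = 2 * card E"
proof -
  have "(\<Sum>v\<in>V. deg E h v) = card (\<Union>v\<in>V. {\<alpha>. fst \<alpha> \<in> E \<and> h \<alpha> = v})"
    unfolding deg_def using assms(2) finite_half_edges[OF assms(1)]
    by (subst card_UN_disjoint) auto
  also have "(\<Union>v\<in>V. {\<alpha>. fst \<alpha> \<in> E \<and> h \<alpha> = v}) = E \<times> UNIV" using assms(3) by auto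
  finally show ?thesis by (simp add: card_cartesian_product)
qed

lemma deg_exchange: "exchange E P h h' \<Longrightarrow> deg E h' v = deg E h v"
  unfolding exchange_def by (auto intro!: deg_permute permutes_swap_id)

section \<open>Trees given by cuts\<close>

text \<open>Connectedness is expressed by cuts instead of walks, since an exchange destroys walks but
respects every cut that does not separate the ends of its pivot.\<close>

definition cut_connected :: "('e \<times> bool \<Rightarrow> 'v) \<Rightarrow> 'v set \<Rightarrow> 'e set \<Rightarrow> bool" where
  "cut_connected h R P \<longleftrightarrow>
     (\<forall>A. A \<subseteq> R \<longrightarrow> A \<noteq> {} \<longrightarrow> A \<noteq> R \<longrightarrow> (\<exists>\<alpha>. fst \<alpha> \<in> P \<and> h \<alpha> \<in> A \<and> h (mate \<alpha>) \<in> R - A))"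

text \<open>Connectedness together with the right number of edges characterizes trees and, unlike
acyclicity, is visibly preserved by exchanges.\<close>

definition tree_on :: "('e \<times> bool \<Rightarrow> 'v) \<Rightarrow> 'v set \<Rightarrow> 'e set \<Rightarrow> bool" where
  "tree_on h R P \<longleftrightarrow> finite R \<and> finite P \<and> (\<forall>\<alpha>. fst \<alpha> \<in> P \<longrightarrow> h \<alpha> \<in> R) \<and>
     cut_connected h R P \<and> card R = card P + 1"

lemma cut_connectedD:
  assumes "cut_connected h R P" "A \<subseteq> R" "A \<noteq> {}" "A \<noteq> R"
  obtains \<alpha> where "fst \<alpha> \<in> P" "h \<alpha> \<in> A" "h (mate \<alpha>) \<in> R - A"
  using assms unfolding cut_connected_def by blast

lemma tree_onD:
  assumes "tree_on h R P"
  shows "finite R" "finite P" "fst \<alpha> \<in> P \<Longrightarrow> h \<alpha> \<in> R" "cut_connected h R P" "card R = card P + 1"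
  using assms by (auto simp: tree_on_def)

lemma tree_on_transport:
  assumes t: "tree_on h R P"
    and \<rho>: "\<And>\<alpha>. \<rho> (mate \<alpha>) = mate (\<rho> \<alpha>)" "\<rho> ` {\<alpha>. fst \<alpha> \<in> Q} = {\<alpha>. fst \<alpha> \<in> P}"
    and Q: "finite Q" "card Q = card P" and f: "inj_on f R"
  shows "tree_on (f \<circ> h \<circ> \<rho>) (f ` R) Q"
proof -
  note tD = tree_onD[OF t]
  have "cut_connected (f \<circ> h \<circ> \<rho>) (f ` R) Q"
    unfolding cut_connected_def
  proof (intro allI impI)
    fix A assume A: "A \<subseteq> f ` R" "A \<noteq> {}" "A \<noteq> f ` R"
    define B where "B = {v \<in> R. f v \<in> A}"
    have "B \<subseteq> R" "B \<noteq> {}" "B \<noteq> R" using A by (auto simp: B_def)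
    then obtain \<alpha> where \<alpha>: "fst \<alpha> \<in> P" "h \<alpha> \<in> B" "h (mate \<alpha>) \<in> R - B"
      using cut_connectedD[OF tD(4)] by metis
    obtain \<beta> where "\<alpha> = \<rho> \<beta>" "fst \<beta> \<in> Q" using \<rho>(2) \<alpha>(1) by blast
    then show "\<exists>\<alpha>. fst \<alpha> \<in> Q \<and> (f \<circ> h \<circ> \<rho>) \<alpha> \<in> A \<and> (f \<circ> h \<circ> \<rho>) (mate \<alpha>) \<in> f ` R - A"
      using \<alpha> \<rho>(1) by (intro exI[of _ \<beta>]) (auto simp: B_def)
  qed
  moreover have "(f \<circ> h \<circ> \<rho>) \<alpha> \<in> f ` R" if "fst \<alpha> \<in> Q" for \<alpha>
  proof -
    have "fst (\<rho> \<alpha>) \<in> P" using \<rho>(2) that by blast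
    then show ?thesis using tD(3) by simp
  qed
  ultimately show ?thesis using tD Q f unfolding tree_on_def by (simp add: card_image)
qed

text \<open>A cut either separates the ends of the pivot, which then crosses it, or has both ends on one
side; in the latter case the exchange moves no half-edge across the cut.\<close>

lemma tree_on_exchange:
  assumes "exchange E P h h'" "tree_on h R P"
  shows "tree_on h' R P"
proof -
  obtain \<epsilon> \<alpha> \<beta> where \<epsilon>: "fst \<epsilon> \<in> P" and ne: "fst \<alpha> \<noteq> fst \<epsilon>" "fst \<beta> \<noteq> fst \<epsilon>"
    and h: "h \<alpha> = h \<epsilon>" "h \<beta> = h (mate \<epsilon>)" and h': "h' = h \<circ> transpose \<alpha> \<beta>"
    using assms(1) unfolding exchange_def by auto
  have R: "h \<gamma> \<in> R" if "fst \<gamma> \<in> P" for \<gamma> using assms(2) that by (auto simp: tree_on_def)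
  have hR: "h \<epsilon> \<in> R" "h (mate \<epsilon>) \<in> R" using R \<epsilon> by auto
  have "cut_connected h' R P"
    unfolding cut_connected_def
  proof (intro allI impI)
    fix A assume A: "A \<subseteq> R" "A \<noteq> {}" "A \<noteq> R"
    have [simp]: "h' \<epsilon> = h \<epsilon>" "h' (mate \<epsilon>) = h (mate \<epsilon>)"
      using ne by (auto simp: h' transpose_def)
    show "\<exists>\<kappa>. fst \<kappa> \<in> P \<and> h' \<kappa> \<in> A \<and> h' (mate \<kappa>) \<in> R - A"
    proof (cases "h \<epsilon> \<in> A \<longleftrightarrow> h (mate \<epsilon>) \<in> A")
      case True
      have same: "h' \<gamma> \<in> A \<longleftrightarrow> h \<gamma> \<in> A" "h' \<gamma> \<in> R \<longleftrightarrow> h \<gamma> \<in> R" for \<gamma>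
        using True h hR by (auto simp: h' transpose_def)
      obtain \<kappa> where "fst \<kappa> \<in> P" "h \<kappa> \<in> A" "h (mate \<kappa>) \<in> R - A"
        using assms(2) A unfolding tree_on_def by (blast elim: cut_connectedD)
      then show ?thesis using same by (intro exI[of _ \<kappa>]) auto
    next
      case False
      then show ?thesis
        using \<epsilon> hR by (cases "h \<epsilon> \<in> A") (auto intro: exI[of _ \<epsilon>] exI[of _ "mate \<epsilon>"])
    qed
  qed
  moreover have "h' \<gamma> \<in> R" if "fst \<gamma> \<in> P" for \<gamma>
    using R[OF that] h hR by (auto simp: h' transpose_def)
  ultimately show ?thesis using assms(2) by (auto simp: tree_on_def)
qed

lemma exchanges_invariant:
  assumes "(exchange E P)\<^sup>*\<^sup>* h h'" "tree_on h R P"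
  shows "tree_on h' R P \<and> (\<forall>v. deg E h' v = deg E h v) \<and>
    (\<forall>\<alpha>. h' \<alpha> = h \<alpha> \<or> h \<alpha> \<in> R \<and> h' \<alpha> \<in> R)"
  using assms(1)
proof (induction rule: rtranclp_induct)
  case (step h1 h2)
  have "h2 \<gamma> = h1 \<gamma> \<or> h1 \<gamma> \<in> R \<and> h2 \<gamma> \<in> R" for \<gamma>
  proof -
    obtain \<epsilon> \<alpha> \<beta> where \<epsilon>: "fst \<epsilon> \<in> P" and h: "h1 \<alpha> = h1 \<epsilon>" "h1 \<beta> = h1 (mate \<epsilon>)"
      and h2: "h2 = h1 \<circ> transpose \<alpha> \<beta>" using step.hyps(2) unfolding exchange_def by blast
    have "h1 \<epsilon> \<in> R" "h1 (mate \<epsilon>) \<in> R" using tree_onD(3)[of h1 R P] step.IH \<epsilon> by auto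
    then show ?thesis using h by (auto simp: h2 transpose_def)
  qed
  then show ?case
    using step tree_on_exchange[OF step.hyps(2)] deg_exchange[OF step.hyps(2)] by metis
qed (use assms in auto)

lemma tree_on_remove_leaf:
  assumes "tree_on h R P" "R \<noteq> {v}" "v \<in> R"
    and v: "\<And>\<alpha>. fst \<alpha> \<in> P \<Longrightarrow> h \<alpha> = v \<Longrightarrow> \<alpha> = \<beta>" and \<beta>: "fst \<beta> \<in> P" "h \<beta> = v"
  shows "tree_on h (R - {v}) (P - {fst \<beta>})"
proof -
  have t: "finite R" "finite P" "\<And>\<alpha>. fst \<alpha> \<in> P \<Longrightarrow> h \<alpha> \<in> R" "cut_connected h R P"
    "card R = card P + 1" using assms(1) by (auto simp: tree_on_def)
  let ?w = "h (mate \<beta>)"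
  have w: "?w \<in> R - {v}"
    using t(3)[of "mate \<beta>"] \<beta> v[of "mate \<beta>"] by auto
  have "cut_connected h (R - {v}) (P - {fst \<beta>})"
    unfolding cut_connected_def
  proof (intro allI impI)
    fix A assume A: "A \<subseteq> R - {v}" "A \<noteq> {}" "A \<noteq> R - {v}"
    \<comment> \<open>put \<open>v\<close> on the side of its only neighbour, so that the edge between them does not cross\<close>
    define B where "B = (if ?w \<in> A then insert v A else A)"
    have "B \<subseteq> R" "B \<noteq> {}" "B \<noteq> R" using A \<open>v \<in> R\<close> by (auto simp: B_def)
    then obtain \<alpha> where \<alpha>: "fst \<alpha> \<in> P" "h \<alpha> \<in> B" "h (mate \<alpha>) \<in> R - B"
      using cut_connectedD[OF t(4)] by metis
    have "\<alpha> \<noteq> \<beta>" "\<alpha> \<noteq> mate \<beta>" using \<alpha> \<beta> A w by (auto simp: B_def split: if_splits)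
    then have "fst \<alpha> \<noteq> fst \<beta>" by (simp add: fst_eq_iff_mate)
    moreover have "h \<alpha> \<noteq> v" "h (mate \<alpha>) \<noteq> v"
      using v[of \<alpha>] v[of "mate \<alpha>"] \<alpha>(1) \<open>\<alpha> \<noteq> \<beta>\<close> \<open>\<alpha> \<noteq> mate \<beta>\<close> by auto
    ultimately show "\<exists>\<alpha>. fst \<alpha> \<in> P - {fst \<beta>} \<and> h \<alpha> \<in> A \<and> h (mate \<alpha>) \<in> R - {v} - A"
      using \<alpha> by (intro exI[of _ \<alpha>]) (auto simp: B_def split: if_splits)
  qed
  moreover have "h \<alpha> \<in> R - {v}" if "fst \<alpha> \<in> P - {fst \<beta>}" for \<alpha>
    using t(3)[of \<alpha>] v[of \<alpha>] that by auto
  moreover have "card P = Suc (card (P - {fst \<beta>}))" using \<beta>(1) t(2) by (simp only: card_Suc_Diff1)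
  ultimately show ?thesis using t \<beta> \<open>v \<in> R\<close> by (auto simp: tree_on_def)
qed

text \<open>The degrees within a tree sum to \<open>2 * card R - 2\<close>, so they cannot all be at least 2.\<close>

lemma tree_on_has_leaf:
  assumes "tree_on h R P" "card R \<ge> 2"
  obtains v \<beta> where "v \<in> R" "{\<alpha>. fst \<alpha> \<in> P \<and> h \<alpha> = v} = {\<beta>}"
proof -
  have t: "finite R" "finite P" "\<And>\<alpha>. fst \<alpha> \<in> P \<Longrightarrow> h \<alpha> \<in> R" "cut_connected h R P"
    "card R = card P + 1" using assms(1) by (auto simp: tree_on_def)
  have "\<exists>v\<in>R. deg P h v < 2"
  proof (rule ccontr)
    assume "\<not> ?thesis"
    then have "card R * 2 \<le> (\<Sum>v\<in>R. deg P h v)"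
      using sum_bounded_below[of R 2 "deg P h"] by (simp add: not_less)
    also have "\<dots> = 2 * card P" using handshake[OF t(2,1,3)] .
    finally show False using t(5) by simp
  qed
  then obtain v where v: "v \<in> R" "deg P h v < 2" by auto
  have "{v} \<noteq> R" using assms(2) by auto
  then obtain \<alpha> where "fst \<alpha> \<in> P" "h \<alpha> = v"
    using cut_connectedD[OF t(4), of "{v}"] v(1) by blast
  then have "deg P h v \<noteq> 0" using finite_half_edges[OF t(2)] by (auto simp: deg_def)
  with v(2) have "card {\<alpha>. fst \<alpha> \<in> P \<and> h \<alpha> = v} = 1" by (simp add: deg_def)
  then show thesis using v(1) that by (metis card_1_singletonE)
qed

section \<open>Collecting half-edges at a vertex\<close>

text \<open>A path is the list of the half-edges by which it leaves its vertices. The condition on \<open>x\<close>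
makes the vertices pairwise distinct, which guarantees that an exchange across the first edge does
not touch the rest of the path beyond the second vertex.\<close>

fun half_path :: "('e \<times> bool \<Rightarrow> 'v) \<Rightarrow> 'e set \<Rightarrow> 'v \<Rightarrow> ('e \<times> bool) list \<Rightarrow> 'v \<Rightarrow> bool" where
  "half_path h P x [] y \<longleftrightarrow> x = y"
| "half_path h P x (\<alpha> # \<alpha>s) y \<longleftrightarrow>
     fst \<alpha> \<in> P \<and> h \<alpha> = x \<and> x \<notin> insert y (h ` set \<alpha>s) \<and> half_path h P (h (mate \<alpha>)) \<alpha>s y"

lemma half_path_suffix:
  assumes "half_path h P x \<alpha>s y" "z \<in> h ` set \<alpha>s"
  shows "\<exists>\<beta>s. half_path h P z \<beta>s y"
  using assms
proof (induction \<alpha>s arbitrary: x)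
  case (Cons \<alpha> \<alpha>s)
  show ?case
  proof (cases "z = h \<alpha>")
    case True
    then show ?thesis using Cons.prems by (intro exI[of _ "\<alpha> # \<alpha>s"]) simp
  qed (use Cons in auto)
qed simp

text \<open>If the vertices from which \<open>y\<close> can be reached did not exhaust \<open>R\<close>, some edge would leave
this set. Its outer end is not a vertex of the path from its inner end to \<open>y\<close>, since a suffix of
that path would lead from there to \<open>y\<close>; so the edge can be put in front of the path.\<close>

lemma cut_connected_half_path:
  assumes "cut_connected h R P" "x \<in> R" "y \<in> R"
  obtains \<alpha>s where "half_path h P x \<alpha>s y"
proof -
  define A where "A = {x \<in> R. \<exists>\<alpha>s. half_path h P x \<alpha>s y}"
  have "y \<in> A" using assms by (auto simp: A_def intro: exI[of _ "[]"])
  have "A = R"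
  proof (rule ccontr)
    assume "A \<noteq> R"
    moreover have "A \<subseteq> R" "A \<noteq> {}" using \<open>y \<in> A\<close> by (auto simp: A_def)
    ultimately obtain \<alpha> where \<alpha>: "fst \<alpha> \<in> P" "h \<alpha> \<in> A" "h (mate \<alpha>) \<in> R - A"
      using cut_connectedD[OF assms(1)] by metis
    then obtain \<alpha>s where p: "half_path h P (h \<alpha>) \<alpha>s y" by (auto simp: A_def)
    have "h (mate \<alpha>) \<notin> insert y (h ` set \<alpha>s)"
      using half_path_suffix[OF p] \<alpha> \<open>y \<in> A\<close> by (auto simp: A_def)
    then have "half_path h P (h (mate \<alpha>)) (mate \<alpha> # \<alpha>s) y" using p \<alpha> by simp
    then show False using \<alpha> unfolding A_def by blast
  qed
  then show thesis using assms(2) that by (auto simp: A_def)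
qed

lemma half_path_edges: "half_path h P x \<alpha>s y \<Longrightarrow> fst ` set \<alpha>s \<subseteq> P"
  by (induction \<alpha>s arbitrary: x) auto

lemma half_path_cong:
  assumes "half_path h P x \<alpha>s y"
    and "\<And>\<alpha>. \<alpha> \<in> set \<alpha>s \<Longrightarrow> h' \<alpha> = h \<alpha> \<and> h' (mate \<alpha>) = h (mate \<alpha>)"
  shows "half_path h' P x \<alpha>s y"
  using assms by (induction \<alpha>s arbitrary: x) (auto simp: image_iff)

lemma half_path_mate:
  assumes "half_path h P x \<alpha>s y" "\<alpha> \<in> set \<alpha>s"
  shows "h (mate \<alpha>) \<in> insert y (h ` set \<alpha>s)"
  using assms
proof (induction \<alpha>s arbitrary: x)
  case (Cons \<beta> \<alpha>s)
  have "h (mate \<beta>) \<in> insert y (h ` set \<alpha>s)" using Cons.prems(1) by (cases \<alpha>s) auto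
  then show ?case using Cons by auto
qed simp

text \<open>The vertex \<open>v\<close> travels towards \<open>s\<close>: each exchange across the first edge of the path gives away
some half-edge \<open>\<gamma>\<close> outside \<open>S\<close> and takes over the next half-edge of the path, which therefore
becomes the first edge of a shorter path from \<open>v\<close>.\<close>

lemma capture_along_path:
  assumes "half_path h P v \<alpha>s (h s)" "h s \<noteq> v" "finite E" "P \<subseteq> E"
    and S: "\<And>t. t \<in> S \<Longrightarrow> fst t \<in> E - P" "s \<in> S" "card S < deg E h v"
  shows "\<exists>h'. (exchange E P)\<^sup>*\<^sup>* h h' \<and> h' s = v \<and> (\<forall>t\<in>S. h t = v \<longrightarrow> h' t = v)"
  using assms(1,2) S(3)
proof (induction \<alpha>s arbitrary: h)
  case (Cons \<alpha> \<alpha>s)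
  have \<alpha>: "fst \<alpha> \<in> P" "h \<alpha> = v" and v: "v \<noteq> h s" "v \<notin> h ` set \<alpha>s"
    and p: "half_path h P (h (mate \<alpha>)) \<alpha>s (h s)" using Cons.prems by auto
  have mv: "h (mate \<alpha>) \<noteq> v" using p v by (cases \<alpha>s) auto
  have "finite S" using S(1) assms(3) finite_subset[of S "E \<times> UNIV"] by fastforce
  \<comment> \<open>the half-edges at \<open>v\<close> outnumber \<open>S\<close>, and \<open>s\<close> is not among them: besides \<open>\<alpha>\<close> one more can be spared\<close>
  have "\<not> {\<gamma>. fst \<gamma> \<in> E \<and> h \<gamma> = v} \<subseteq> insert \<alpha> (S - {s})"
  proof
    assume "{\<gamma>. fst \<gamma> \<in> E \<and> h \<gamma> = v} \<subseteq> insert \<alpha> (S - {s})"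
    then have "deg E h v \<le> card (insert \<alpha> (S - {s}))"
      unfolding deg_def using \<open>finite S\<close> by (intro card_mono) auto
    also have "\<dots> \<le> card S" using \<open>finite S\<close> \<open>s \<in> S\<close>
      by (metis card_insert_le_m1 card_gt_0_iff card_Diff_singleton empty_iff le_refl)
    finally show False using Cons.prems(3) by simp
  qed
  then obtain \<gamma> where \<gamma>: "fst \<gamma> \<in> E" "h \<gamma> = v" "\<gamma> \<noteq> \<alpha>" "\<gamma> \<notin> S" using v by auto
  have \<gamma>\<alpha>: "fst \<gamma> \<noteq> fst \<alpha>" using \<gamma> mv by (auto simp: fst_eq_iff_mate)
  have step: "exchange E P h (h \<circ> transpose \<gamma> \<beta>)"
    if "fst \<beta> \<in> E - {fst \<alpha>}" "h \<beta> = h (mate \<alpha>)" for \<beta>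
    unfolding exchange_def using that \<alpha> \<gamma> \<gamma>\<alpha> by (intro exI[of _ \<alpha>] exI[of _ \<gamma>] exI[of _ \<beta>]) auto
  show ?case
  proof (cases \<alpha>s)
    case Nil
    then have "exchange E P h (h \<circ> transpose \<gamma> s)"
      using p S(1)[OF \<open>s \<in> S\<close>] \<alpha> by (intro step) auto
    moreover have "(h \<circ> transpose \<gamma> s) t = v" if "t \<in> S" "h t = v" for t
      using that \<gamma> v by (auto simp: transpose_def)
    ultimately show ?thesis using \<gamma>
      by (intro exI[of _ "h \<circ> transpose \<gamma> s"]) (auto simp del: o_apply simp: comp_def)
  next
    case (Cons \<beta> \<beta>s)
    let ?h = "h \<circ> transpose \<gamma> \<beta>"
    have \<beta>: "fst \<beta> \<in> P" "h \<beta> = h (mate \<alpha>)" and p': "half_path h P (h (mate \<beta>)) \<beta>s (h s)"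
      and m: "h (mate \<alpha>) \<notin> insert (h s) (h ` set \<beta>s)" using p Cons by auto
    have "h (mate \<beta>) \<in> insert (h s) (h ` set \<beta>s)" using p' by (cases \<beta>s) auto
    moreover have vs: "v \<notin> insert (h s) (h ` set \<beta>s)" using v Cons by auto
    ultimately have m\<beta>: "h (mate \<beta>) \<noteq> v" "h (mate \<beta>) \<noteq> h (mate \<alpha>)" using m by metis+
    have "fst \<beta> \<noteq> fst \<alpha>"
      using m\<beta> \<beta> \<alpha> mv by (auto simp: fst_eq_iff_mate)
    then have ex: "exchange E P h ?h" using \<beta> \<open>P \<subseteq> E\<close> by (intro step) auto
    have off: "?h \<delta> = h \<delta>" if "h \<delta> \<noteq> v" "h \<delta> \<noteq> h (mate \<alpha>)" for \<delta>
      using that \<gamma> \<beta> by (auto simp: transpose_def)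
    have "h s \<noteq> v" "h s \<noteq> h (mate \<alpha>)" using v m by auto
    then have hs: "?h s = h s" by (rule off)
    have on: "?h \<delta> = h \<delta> \<and> ?h (mate \<delta>) = h (mate \<delta>)" if "\<delta> \<in> set \<beta>s" for \<delta>
    proof -
      have "h \<delta> \<in> insert (h s) (h ` set \<beta>s)" using that by simp
      then show ?thesis using half_path_mate[OF p' that] vs m by (metis off)
    qed
    have "half_path ?h P (h (mate \<beta>)) \<beta>s (h s)"
      using p' on by (rule half_path_cong)
    moreover have "?h \<beta> = v" using \<gamma> by simp
    moreover have "?h (mate \<beta>) = h (mate \<beta>)" using m\<beta> by (rule off)
    moreover have "?h ` set \<beta>s = h ` set \<beta>s" using on by (intro image_cong) auto
    ultimately have "half_path ?h P v \<alpha>s (?h s)"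
      using Cons \<beta>(1) v hs by (simp del: o_apply)
    moreover have "?h s \<noteq> v" using hs v by simp
    moreover have "card S < deg E ?h v" using deg_exchange[OF ex] Cons.prems(3) by simp
    ultimately obtain h' where h': "(exchange E P)\<^sup>*\<^sup>* ?h h'" "h' s = v"
      "\<forall>t\<in>S. ?h t = v \<longrightarrow> h' t = v" using Cons.IH by blast
    have "?h t = v" if "t \<in> S" "h t = v" for t
      using that \<gamma> \<beta> S(1)[OF that(1)] by (auto simp: transpose_def)
    then show ?thesis using h' ex by (intro exI[of _ h']) (auto intro: converse_rtranclp_into_rtranclp)
  qed
qed simp

lemma capture_set:
  assumes "tree_on h R P" "v \<in> R" "finite E" "P \<subseteq> E"
    and S: "\<And>t. t \<in> S \<Longrightarrow> fst t \<in> E - P \<and> h t \<in> R" "card S < deg E h v"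
  shows "\<exists>h'. (exchange E P)\<^sup>*\<^sup>* h h' \<and> (\<forall>t\<in>S. h' t = v)"
  using assms(1) S
proof (induction "card {t \<in> S. h t \<noteq> v}" arbitrary: h rule: less_induct)
  case less
  have "finite S" using less.prems(2) assms(3) finite_subset[of S "E \<times> UNIV"] by fastforce
  show ?case
  proof (cases "\<forall>t\<in>S. h t = v")
    case False
    then obtain s where s: "s \<in> S" "h s \<noteq> v" by auto
    obtain \<alpha>s where "half_path h P v \<alpha>s (h s)"
      using cut_connected_half_path[OF tree_onD(4)[OF less.prems(1)] assms(2)] less.prems(2) s(1)
      by metis
    from capture_along_path[OF this s(2) assms(3,4) _ s(1) less.prems(3)] less.prems(2)
    obtain h1 where h1: "(exchange E P)\<^sup>*\<^sup>* h h1" "h1 s = v" "\<forall>t\<in>S. h t = v \<longrightarrow> h1 t = v"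
      by blast
    note inv = exchanges_invariant[OF h1(1) less.prems(1)]
    have "card {t \<in> S. h1 t \<noteq> v} < card {t \<in> S. h t \<noteq> v}"
      using h1 s \<open>finite S\<close> by (intro psubset_card_mono) auto
    moreover have "tree_on h1 R P" "card S < deg E h1 v" using inv less.prems(3) by simp_all
    moreover have "fst t \<in> E - P \<and> h1 t \<in> R" if "t \<in> S" for t
      using inv[THEN conjunct2, THEN conjunct2, rule_format, of t] less.prems(2)[OF that] by auto
    ultimately obtain h2 where "(exchange E P)\<^sup>*\<^sup>* h1 h2" "\<forall>t\<in>S. h2 t = v"
      using less.hyps[of h1] by blast
    then show ?thesis using h1(1) by (meson rtranclp_trans)
  qed auto
qed


section \<open>Rearranging one tree into another\<close>

text \<open>Induction on the number of vertices. A leaf \<open>v\<close> of the target tree \<open>h'\<close> is made a leaf of the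
source tree by collecting the dangling half-edges \<open>S\<close> that \<open>v\<close> has in the target. Its remaining
half-edges \<open>\<beta>\<close> and \<open>\<beta>'\<close> in the two trees may belong to different tree edges, or to different halves
of the same one; relabelling the target by \<open>\<rho>\<^sub>0\<close> makes them agree, so that \<open>v\<close> can be removed from
both trees. The relabellings accumulate in \<open>\<rho>\<close>, which for this reason is confined to tree edges.\<close>

lemma tree_rearrangement:
  fixes h h' :: "'e \<times> bool \<Rightarrow> 'v"
  assumes "tree_on h R P" "tree_on h' R P" "finite E" "P \<subseteq> E"
    and "\<And>\<alpha>. fst \<alpha> \<in> E \<Longrightarrow> h \<alpha> = h' \<alpha> \<or> h \<alpha> \<in> R \<and> h' \<alpha> \<in> R"
    and "\<And>v. v \<in> R \<Longrightarrow> deg E h v = deg E h' v"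
  shows "\<exists>h1 \<rho>. (exchange E P)\<^sup>*\<^sup>* h h1 \<and> \<rho> permutes {\<alpha>. fst \<alpha> \<in> P} \<and>
    (\<forall>\<alpha>. \<rho> (mate \<alpha>) = mate (\<rho> \<alpha>)) \<and> (\<forall>\<alpha>. fst \<alpha> \<in> E \<longrightarrow> h1 \<alpha> = h' (\<rho> \<alpha>))"
  using assms
proof (induction "card R" arbitrary: R P h h' rule: less_induct)
  case less
  note t = tree_onD[OF less.prems(1)] and t' = tree_onD[OF less.prems(2)]
  show ?case
  proof (cases "card R \<ge> 2")
    case False
    then have "card R = 1" using t(5) by simp
    then obtain v where "R = {v}" by (metis card_1_singletonE)
    then have "h \<alpha> = h' \<alpha>" if "fst \<alpha> \<in> E" for \<alpha> using less.prems(5)[OF that] by auto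
    then show ?thesis by (intro exI[of _ h] exI[of _ id]) (auto simp: permutes_id)
  next
    case True
    obtain v \<beta>' where v: "v \<in> R" and \<beta>': "{\<alpha>. fst \<alpha> \<in> P \<and> h' \<alpha> = v} = {\<beta>'}"
      using tree_on_has_leaf[OF less.prems(2) True] .
    then have \<beta>'P: "fst \<beta>' \<in> P" "h' \<beta>' = v" by auto
    have at_v': "\<alpha> = \<beta>'" if "fst \<alpha> \<in> P" "h' \<alpha> = v" for \<alpha>
      using eqset_imp_iff[OF \<beta>', of \<alpha>] that by simp
    have Rv: "R \<noteq> {v}" using True by auto
    define S where "S = {\<alpha>. fst \<alpha> \<in> E \<and> h' \<alpha> = v} - {\<beta>'}"
    have SP: "fst s \<in> E - P" if "s \<in> S" for s using that at_v'[of s] by (auto simp: S_def)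
    have "finite S" unfolding S_def using finite_half_edges[OF less.prems(3)] by auto
    have "{\<alpha>. fst \<alpha> \<in> E \<and> h' \<alpha> = v} = insert \<beta>' S" using \<beta>'P less.prems(4) by (auto simp: S_def)
    moreover have "\<beta>' \<notin> S" by (simp add: S_def)
    ultimately have dv: "deg E h v = Suc (card S)"
      using less.prems(6)[OF v] \<open>finite S\<close> by (simp add: deg_def)
    have "h s \<in> R" if "s \<in> S" for s using less.prems(5)[of s] that v by (auto simp: S_def)
    then obtain h1 where h1: "(exchange E P)\<^sup>*\<^sup>* h h1" "\<forall>s\<in>S. h1 s = v"
      using capture_set[OF less.prems(1) v less.prems(3,4), of S] SP dv by auto
    have t1: "tree_on h1 R P" and d1: "deg E h1 w = deg E h w"
      and l1: "h1 \<alpha> = h \<alpha> \<or> h \<alpha> \<in> R \<and> h1 \<alpha> \<in> R" for w \<alpha>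
      using exchanges_invariant[OF h1(1) less.prems(1)] by auto
    obtain \<beta> where \<beta>: "fst \<beta> \<in> P" "h1 \<beta> = v"
      using cut_connectedD[OF tree_onD(4)[OF t1], of "{v}"] v Rv by blast
    have ins: "insert \<beta> S = {\<alpha>. fst \<alpha> \<in> E \<and> h1 \<alpha> = v}"
    proof (rule card_subset_eq)
      show "insert \<beta> S \<subseteq> {\<alpha>. fst \<alpha> \<in> E \<and> h1 \<alpha> = v}" using \<beta> h1(2) SP less.prems(4) by auto
      have "\<beta> \<notin> S" using \<beta> SP by blast
      then show "card (insert \<beta> S) = card {\<alpha>. fst \<alpha> \<in> E \<and> h1 \<alpha> = v}"
        using d1[of v] dv \<open>finite S\<close> by (simp add: deg_def)
    qed (rule finite_half_edges[OF less.prems(3)])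
    have at_v: "h1 \<alpha> = v \<longleftrightarrow> \<alpha> = \<beta> \<or> \<alpha> \<in> S" if "fst \<alpha> \<in> E" for \<alpha>
      using eqset_imp_iff[OF ins, of \<alpha>] that by simp
    \<comment> \<open>the automorphism of the half-edges of \<open>P\<close> that interchanges the two tree edges at \<open>v\<close>\<close>
    define \<rho>\<^sub>0 where "\<rho>\<^sub>0 = (\<lambda>\<alpha>. (transpose (fst \<beta>) (fst \<beta>') (fst \<alpha>),
      if fst \<alpha> \<in> {fst \<beta>, fst \<beta>'} then snd \<alpha> \<noteq> (snd \<beta> \<noteq> snd \<beta>') else snd \<alpha>))"
    have \<rho>\<beta>: "\<rho>\<^sub>0 \<beta> = \<beta>'" by (auto simp: \<rho>\<^sub>0_def prod_eq_iff)
    have \<rho>mate: "\<rho>\<^sub>0 (mate \<alpha>) = mate (\<rho>\<^sub>0 \<alpha>)" for \<alpha> by (auto simp: \<rho>\<^sub>0_def mate_def)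
    have \<rho>\<rho>: "\<rho>\<^sub>0 (\<rho>\<^sub>0 \<alpha>) = \<alpha>" for \<alpha> by (auto simp: \<rho>\<^sub>0_def prod_eq_iff transpose_def)
    have \<rho>E: "fst (\<rho>\<^sub>0 \<alpha>) \<in> E \<longleftrightarrow> fst \<alpha> \<in> E" "fst (\<rho>\<^sub>0 \<alpha>) \<in> P \<longleftrightarrow> fst \<alpha> \<in> P"
      "fst (\<rho>\<^sub>0 \<alpha>) = fst \<beta>' \<longleftrightarrow> fst \<alpha> = fst \<beta>" for \<alpha>
      using \<beta>(1) \<beta>'P(1) less.prems(4) by (auto simp: \<rho>\<^sub>0_def transpose_def)
    have \<rho>out: "\<rho>\<^sub>0 \<alpha> = \<alpha>" if "fst \<alpha> \<notin> P" for \<alpha>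
      using that \<beta>(1) \<beta>'P(1) by (auto simp: \<rho>\<^sub>0_def transpose_def prod_eq_iff)
    have \<rho>perm: "\<rho>\<^sub>0 permutes {\<alpha>. fst \<alpha> \<in> P}"
      unfolding permutes_def
    proof (intro conjI allI impI)
      show "\<exists>!\<alpha>. \<rho>\<^sub>0 \<alpha> = \<gamma>" for \<gamma> using \<rho>\<rho> by metis
    qed (use \<rho>out in auto)
    let ?R = "R - {v}" and ?P = "P - {fst \<beta>}"
    have r1: "tree_on h1 ?R ?P"
    proof (rule tree_on_remove_leaf[OF t1 Rv v _ \<beta>])
      fix \<alpha> assume "fst \<alpha> \<in> P" "h1 \<alpha> = v"
      then show "\<alpha> = \<beta>" using at_v[of \<alpha>] SP[of \<alpha>] less.prems(4) by blast
    qed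
    have "tree_on (id \<circ> h' \<circ> \<rho>\<^sub>0) (id ` ?R) ?P"
    proof (rule tree_on_transport)
      show "tree_on h' ?R (P - {fst \<beta>'})"
        by (rule tree_on_remove_leaf[OF less.prems(2) Rv v at_v' \<beta>'P])
      show "\<rho>\<^sub>0 ` {\<alpha>. fst \<alpha> \<in> ?P} = {\<alpha>. fst \<alpha> \<in> P - {fst \<beta>'}}" (is "_ ` ?A = ?B")
      proof (intro equalityI subsetI)
        fix \<gamma> assume "\<gamma> \<in> ?B"
        then have "\<rho>\<^sub>0 \<gamma> \<in> ?A" using \<rho>E(2,3)[of "\<rho>\<^sub>0 \<gamma>"] \<rho>\<rho> by simp
        then show "\<gamma> \<in> \<rho>\<^sub>0 ` ?A" using \<rho>\<rho>[of \<gamma>] by (metis imageI)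
      qed (use \<rho>E in auto)
      show "card ?P = card (P - {fst \<beta>'})" using \<beta>(1) \<beta>'P(1) t(2) by simp
    qed (use \<rho>mate t in auto)
    then have r2: "tree_on (h' \<circ> \<rho>\<^sub>0) ?R ?P" by simp
    have r3: "h1 \<alpha> = (h' \<circ> \<rho>\<^sub>0) \<alpha> \<or> h1 \<alpha> \<in> ?R \<and> (h' \<circ> \<rho>\<^sub>0) \<alpha> \<in> ?R" if \<alpha>: "fst \<alpha> \<in> E" for \<alpha>
    proof (cases "h1 \<alpha> = v")
      case True
      then consider "\<alpha> = \<beta>" | "\<alpha> \<in> S" using at_v[OF \<alpha>] by blast
      then have "h' (\<rho>\<^sub>0 \<alpha>) = v"
      proof cases
        case 2
        then show ?thesis using \<rho>out[of \<alpha>] SP[of \<alpha>] by (simp add: S_def)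
      qed (use \<rho>\<beta> \<beta>'P in simp)
      then show ?thesis using True by simp
    next
      case False
      then have "\<alpha> \<noteq> \<beta>" "\<alpha> \<notin> S" using at_v[OF \<alpha>] by auto
      have "h' (\<rho>\<^sub>0 \<alpha>) \<noteq> v"
      proof (cases "fst \<alpha> \<in> P")
        case True
        have "\<rho>\<^sub>0 \<alpha> \<noteq> \<beta>'" using \<rho>\<beta> \<rho>\<rho> \<open>\<alpha> \<noteq> \<beta>\<close> by metis
        then show ?thesis using at_v'[of "\<rho>\<^sub>0 \<alpha>"] \<rho>E(2)[of \<alpha>] True by auto
      next
        case False
        then show ?thesis using \<open>\<alpha> \<notin> S\<close> \<alpha> \<beta>'P \<rho>out[of \<alpha>] by (auto simp: S_def)
      qed
      moreover have "h1 \<alpha> = h' (\<rho>\<^sub>0 \<alpha>) \<or> h1 \<alpha> \<in> R \<and> h' (\<rho>\<^sub>0 \<alpha>) \<in> R"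
      proof (cases "fst \<alpha> \<in> P")
        case True
        then show ?thesis using tree_onD(3)[OF t1] t'(3) \<rho>E(2) by auto
      next
        case False
        then show ?thesis using l1[of \<alpha>] less.prems(5)[OF \<alpha>] \<rho>out by auto
      qed
      ultimately show ?thesis using False by auto
    qed
    have r4: "deg E h1 w = deg E (h' \<circ> \<rho>\<^sub>0) w" if "w \<in> ?R" for w
    proof -
      have "\<rho>\<^sub>0 permutes {\<alpha>. fst \<alpha> \<in> E}"
        using \<rho>perm less.prems(4) by (auto intro: permutes_subset)
      then show ?thesis using that d1 less.prems(6) by (simp add: deg_permute)
    qed
    have "?P \<subseteq> E" using less.prems(4) by auto
    from less.hyps[OF card_Diff1_less[OF t(1) v] r1 r2 less.prems(3) this r3 r4]
    obtain h2 \<rho> where h2: "(exchange E ?P)\<^sup>*\<^sup>* h1 h2" "\<rho> permutes {\<alpha>. fst \<alpha> \<in> ?P}"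
      "\<forall>\<alpha>. \<rho> (mate \<alpha>) = mate (\<rho> \<alpha>)" "\<forall>\<alpha>. fst \<alpha> \<in> E \<longrightarrow> h2 \<alpha> = (h' \<circ> \<rho>\<^sub>0) (\<rho> \<alpha>)" by blast
    have "(exchange E P)\<^sup>*\<^sup>* h1 h2"
      using h2(1) by (rule exchanges_mono) auto
    with h1(1) have "(exchange E P)\<^sup>*\<^sup>* h h2" by (rule rtranclp_trans)
    moreover have "\<rho>\<^sub>0 \<circ> \<rho> permutes {\<alpha>. fst \<alpha> \<in> P}"
      using h2(2) \<rho>perm by (intro permutes_compose) (auto intro: permutes_subset)
    ultimately show ?thesis using h2(3,4) \<rho>mate
      by (intro exI[of _ h2] exI[of _ "\<rho>\<^sub>0 \<circ> \<rho>"]) auto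
  qed
qed


section \<open>Multigraphs described by half-edges\<close>

text \<open>The equation \<open>realize G h = G\<close> says that \<open>h\<close> is one of the half-edge descriptions of \<open>G\<close>,
which differ by the order of the two halves of an edge.\<close>

definition realize :: "('v, 'e) mgraph \<Rightarrow> ('e \<times> bool \<Rightarrow> 'v) \<Rightarrow> ('v, 'e) mgraph" where
  "realize G h = G\<lparr>ends := \<lambda>e. Upair (h (e, False)) (h (e, True))\<rparr>"

lemma realize_simps [simp]:
  "verts (realize G h) = verts G" "edges (realize G h) = edges G"
  by (simp_all add: realize_def)

lemma ends_realize: "ends (realize G h) (fst \<alpha>) = Upair (h \<alpha>) (h (mate \<alpha>))"
  by (cases \<alpha>; cases "snd \<alpha>") (auto simp: realize_def mate_def Upair_inject)

lemma mgraph_realize: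
  "mgraph (realize G h) \<longleftrightarrow> finite (verts G) \<and> finite (edges G) \<and>
     (\<forall>\<alpha>. fst \<alpha> \<in> edges G \<longrightarrow> h \<alpha> \<in> verts G)"
  by (auto simp: mgraph_def realize_def split_paired_All all_bool_eq)

lemma degree_realize:
  assumes "finite (edges G)"
  shows "degree (realize G h) v = deg (edges G) h v"
proof -
  let ?A = "\<lambda>i. {e \<in> edges G. h (e, i) = v}"
  have "{\<alpha>. fst \<alpha> \<in> edges G \<and> h \<alpha> = v} = ?A False \<times> {False} \<union> ?A True \<times> {True}"
    by (auto, (metis (full_types))+)
  then have "deg (edges G) h v = card (?A False \<times> {False} \<union> ?A True \<times> {True})"
    by (simp only: deg_def)
  also have "\<dots> = card (?A False) + card (?A True)"
    using assms by (subst card_Un_disjoint) (auto simp: card_cartesian_product)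
  also have "\<dots> = card (?A False \<union> ?A True) + card (?A False \<inter> ?A True)"
    using assms by (intro card_Un_Int) auto
  also have "?A False \<union> ?A True = {e \<in> edges G. v \<in> set_uprod (ends (realize G h) e)}"
    by (auto simp: realize_def)
  also have "?A False \<inter> ?A True = {e \<in> edges G. ends (realize G h) e = Upair v v}"
    by (auto simp: realize_def Upair_inject)
  finally show ?thesis by (simp add: degree_def)
qed

lemma nni_move_of_exchange:
  assumes "exchange (edges G) P h h'" "P \<subseteq> edges G"
    and V: "\<And>\<alpha>. fst \<alpha> \<in> edges G \<Longrightarrow> h \<alpha> \<in> verts G"
  shows "realize G h' = realize G h \<or> (\<exists>e\<in>P. nni_move (realize G h) e (realize G h'))"
proof -
  obtain \<epsilon> \<alpha> \<beta> where \<epsilon>: "fst \<epsilon> \<in> P" and \<alpha>: "fst \<alpha> \<in> edges G" "fst \<alpha> \<noteq> fst \<epsilon>"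
    and \<beta>: "fst \<beta> \<in> edges G" "fst \<beta> \<noteq> fst \<epsilon>"
    and h: "h \<alpha> = h \<epsilon>" "h \<beta> = h (mate \<epsilon>)" and h': "h' = h \<circ> transpose \<alpha> \<beta>"
    using assms(1) unfolding exchange_def by auto
  have off: "ends (realize G h') e = ends (realize G h) e" if "e \<noteq> fst \<alpha>" "e \<noteq> fst \<beta>" for e
    using that by (auto simp: realize_def h' transpose_def)
  show ?thesis
  proof (cases "fst \<alpha> = fst \<beta>")
    case True
    have "ends (realize G h') (fst \<alpha>) = ends (realize G h) (fst \<alpha>)"
      using True unfolding ends_realize h' fst_eq_iff_mate by (auto simp: Upair_inject)
    then have "ends (realize G h') = ends (realize G h)" using True off by (metis ext)
    then show ?thesis by (simp add: realize_def)
  next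
    case False
    let ?x = "h (mate \<alpha>)" and ?u = "h \<epsilon>" and ?v = "h (mate \<epsilon>)" and ?y = "h (mate \<beta>)"
    have "ends (realize G h) (fst \<alpha>) = Upair ?x ?u" "ends (realize G h) (fst \<epsilon>) = Upair ?u ?v"
      "ends (realize G h) (fst \<beta>) = Upair ?v ?y"
      unfolding ends_realize h by (simp_all add: Upair_inject)
    then have "trail (realize G h) ?x [(fst \<alpha>, ?u), (fst \<epsilon>, ?v), (fst \<beta>, ?y)] ?y"
      using \<alpha> \<beta> \<epsilon> False V[of "mate \<beta>"] assms(2) by (auto simp: trail_def)
    moreover have "realize G h' = realize G h\<lparr>ends := (ends (realize G h))
        (fst \<alpha> := Upair ?x ?v, fst \<beta> := Upair ?u ?y)\<rparr>"
    proof -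
      have ne: "mate \<alpha> \<noteq> \<beta>" "mate \<beta> \<noteq> \<alpha>" using False by auto
      have "ends (realize G h') (fst \<alpha>) = Upair ?x ?v" "ends (realize G h') (fst \<beta>) = Upair ?u ?y"
        unfolding ends_realize h' using ne h by (auto simp: transpose_def Upair_inject)
      then have "ends (realize G h') = (ends (realize G h))
        (fst \<alpha> := Upair ?x ?v, fst \<beta> := Upair ?u ?y)" using off by auto
      then show ?thesis by (simp add: realize_def)
    qed
    ultimately show ?thesis unfolding nni_move_def using \<epsilon> by blast
  qed
qed

lemma nni_series_of_exchanges:
  assumes "(exchange (edges G) P)\<^sup>*\<^sup>* h h'" "P \<subseteq> edges G"
    and "\<And>\<alpha>. fst \<alpha> \<in> edges G \<Longrightarrow> h \<alpha> \<in> verts G"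
  shows "\<exists>es. set es \<subseteq> P \<and> nni_series (realize G h) es (realize G h')"
  using assms(1,3)
proof (induction rule: converse_rtranclp_induct)
  case base
  then show ?case by (intro exI[of _ "[]"]) (simp add: nni_refl)
next
  case (step h h1)
  have "h1 \<gamma> \<in> verts G" if "fst \<gamma> \<in> edges G" for \<gamma>
  proof -
    obtain \<alpha> \<beta> where "fst \<alpha> \<in> edges G" "fst \<beta> \<in> edges G" "h1 = h \<circ> transpose \<alpha> \<beta>"
      using step.hyps(1) unfolding exchange_def by blast
    moreover from this have "fst (transpose \<alpha> \<beta> \<gamma>) \<in> edges G" using that by (simp add: transpose_def)
    ultimately show ?thesis using step.prems by simp
  qed
  then obtain es where es: "set es \<subseteq> P" "nni_series (realize G h1) es (realize G h')"
    using step.IH by blast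
  from nni_move_of_exchange[OF step.hyps(1) assms(2) step.prems]
  show ?case
  proof
    assume "realize G h1 = realize G h"
    then show ?thesis using es by auto
  next
    assume "\<exists>e\<in>P. nni_move (realize G h) e (realize G h1)"
    then obtain e where "e \<in> P" "nni_move (realize G h) e (realize G h1)" by auto
    then show ?thesis using es nni_step by (intro exI[of _ "e # es"]) auto
  qed
qed

section \<open>Spanning trees\<close>

lemma connected_imp_cut_connected:
  assumes "connected_mgraph (realize G h)" "mgraph (realize G h)"
  shows "cut_connected h (verts G) (edges G)"
  unfolding cut_connected_def
proof (intro allI impI)
  fix A assume A: "A \<subseteq> verts G" "A \<noteq> {}" "A \<noteq> verts G"
  have crossing: "\<exists>\<alpha>. fst \<alpha> \<in> edges G \<and> h \<alpha> \<in> A \<and> h (mate \<alpha>) \<notin> A"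
    if "walk (realize G h) u p v" "u \<in> A" "v \<notin> A" for u p v
    using that
  proof (induction p arbitrary: u)
    case (Cons s p)
    obtain e w where s: "s = (e, w)" by force
    have "h (e, False) = u \<and> h (e, True) = w \<or> h (e, True) = u \<and> h (e, False) = w" "e \<in> edges G"
      using Cons.prems(1) by (auto simp: s realize_def)
    then obtain \<alpha> where \<alpha>: "fst \<alpha> \<in> edges G" "h \<alpha> = u" "h (mate \<alpha>) = w"
      using that[of "(e, False)"] that[of "(e, True)"] by (auto simp: mate_def)
    show ?case
    proof (cases "w \<in> A")
      case True
      then show ?thesis using Cons by (auto simp: s)
    next
      case False
      then show ?thesis using \<alpha> Cons.prems by auto
    qed
  qed auto
  obtain u v where uv: "u \<in> A" "v \<in> verts G - A" using A by auto
  then have "u \<in> verts G" "v \<in> verts G" using A(1) by auto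
  then obtain p where "walk (realize G h) u p v"
    using assms(1) unfolding connected_mgraph_def realize_simps by blast
  then obtain \<alpha> where "fst \<alpha> \<in> edges G" "h \<alpha> \<in> A" "h (mate \<alpha>) \<notin> A"
    using crossing uv by blast
  moreover from this(1) have "h (mate \<alpha>) \<in> verts G"
    using assms(2) by (simp add: mgraph_realize)
  ultimately show "\<exists>\<alpha>. fst \<alpha> \<in> edges G \<and> h \<alpha> \<in> A \<and> h (mate \<alpha>) \<in> verts G - A" by auto
qed

lemma tree_on_add_leaf:
  assumes "tree_on h R P" "h \<alpha> \<in> R" "h (mate \<alpha>) \<notin> R"
  shows "tree_on h (insert (h (mate \<alpha>)) R) (insert (fst \<alpha>) P)"
proof -
  note t = tree_onD[OF assms(1)]
  let ?w = "h (mate \<alpha>)"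
  have "cut_connected h (insert ?w R) (insert (fst \<alpha>) P)"
    unfolding cut_connected_def
  proof (intro allI impI)
    fix A assume A: "A \<subseteq> insert ?w R" "A \<noteq> {}" "A \<noteq> insert ?w R"
    consider "A = {?w}" | "A = R" | "A \<inter> R \<noteq> {}" "A \<inter> R \<noteq> R" using A by blast
    then show "\<exists>\<kappa>. fst \<kappa> \<in> insert (fst \<alpha>) P \<and> h \<kappa> \<in> A \<and> h (mate \<kappa>) \<in> insert ?w R - A"
    proof cases
      case 1
      then show ?thesis using assms by (intro exI[of _ "mate \<alpha>"]) auto
    next
      case 2
      then show ?thesis using assms by (intro exI[of _ \<alpha>]) auto
    next
      case 3
      then obtain \<kappa> where "fst \<kappa> \<in> P" "h \<kappa> \<in> A \<inter> R" "h (mate \<kappa>) \<in> R - A \<inter> R"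
        using cut_connectedD[OF t(4)] by (metis Int_lower2)
      then show ?thesis by (intro exI[of _ \<kappa>]) auto
    qed
  qed
  moreover have "fst \<alpha> \<notin> P" using t(3)[of "mate \<alpha>"] assms(3) by auto
  moreover have "h \<kappa> \<in> insert ?w R" if "fst \<kappa> \<in> insert (fst \<alpha>) P" for \<kappa>
    using that t(3)[of \<kappa>] assms(2) by (auto simp: fst_eq_iff_mate)
  ultimately show ?thesis using t assms by (simp add: tree_on_def)
qed

text \<open>A maximal tree inside \<open>E\<close> spans \<open>V\<close>, since an edge leaving it would extend it.\<close>

lemma cut_connected_imp_subtree:
  assumes "cut_connected h V E" "finite V" "V \<noteq> {}"
  obtains T where "T \<subseteq> E" "tree_on h V T"
proof -
  let ?Q = "\<lambda>A. A \<noteq> {} \<and> A \<subseteq> V \<and> (\<exists>T\<subseteq>E. tree_on h A T)"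
  obtain v where "v \<in> V" using assms(3) by auto
  then have "?Q {v}" by (intro conjI exI[of _ "{}"]) (auto simp: tree_on_def cut_connected_def)
  then obtain A where A: "?Q A" and max: "\<And>B. ?Q B \<Longrightarrow> card B \<le> card A"
    using ex_has_greatest_nat[of ?Q "{v}" card "Suc (card V)"] assms(2)
    by (metis (no_types, lifting) card_mono le_imp_less_Suc)
  obtain T where T: "T \<subseteq> E" "tree_on h A T" using A by blast
  have "A = V"
  proof (rule ccontr)
    assume "A \<noteq> V"
    then obtain \<alpha> where \<alpha>: "fst \<alpha> \<in> E" "h \<alpha> \<in> A" "h (mate \<alpha>) \<in> V - A"
      using cut_connectedD[OF assms(1)] A by metis
    then have "tree_on h (insert (h (mate \<alpha>)) A) (insert (fst \<alpha>) T)"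
      using tree_on_add_leaf[OF T(2)] by auto
    then have "?Q (insert (h (mate \<alpha>)) A)" using A T \<alpha> by blast
    from max[OF this] show False using \<alpha> tree_onD(1)[OF T(2)] by simp
  qed
  then show thesis using that T by auto
qed

lemma half_path_distinct:
  assumes "half_path h P x \<alpha>s y"
  shows "distinct (map fst \<alpha>s) \<and> distinct (map (h \<circ> mate) \<alpha>s) \<and> x \<notin> (h \<circ> mate) ` set \<alpha>s"
  using assms
proof (induction \<alpha>s arbitrary: x)
  case (Cons \<alpha> \<alpha>s)
  have p: "half_path h P (h (mate \<alpha>)) \<alpha>s y" and \<alpha>: "h \<alpha> = x" "x \<notin> insert y (h ` set \<alpha>s)"
    using Cons.prems by auto
  have sub: "(h \<circ> mate) ` set (\<alpha> # \<alpha>s) \<subseteq> insert y (h ` set \<alpha>s)"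
    using half_path_mate[OF p] p by (cases \<alpha>s) (auto simp: image_subset_iff)
  have "fst \<beta> \<noteq> fst \<alpha>" if "\<beta> \<in> set \<alpha>s" for \<beta>
  proof
    assume "fst \<beta> = fst \<alpha>"
    then have "h \<beta> = x \<or> h (mate \<beta>) = x" using \<alpha>(1) by (auto simp: fst_eq_iff_mate)
    moreover have "h \<beta> \<in> insert y (h ` set \<alpha>s)" "h (mate \<beta>) \<in> insert y (h ` set \<alpha>s)"
      using that half_path_mate[OF p that] by auto
    ultimately show False using \<alpha>(2) by metis
  qed
  then have "fst \<alpha> \<notin> fst ` set \<alpha>s" by (metis imageE)
  moreover have "x \<notin> (h \<circ> mate) ` set (\<alpha> # \<alpha>s)" using sub \<alpha>(2) by blast
  ultimately show ?case using Cons.IH[OF p] by auto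
qed simp

lemma half_path_walk:
  assumes "half_path h P x \<alpha>s y" "P \<subseteq> edges G" "y \<in> verts G"
  shows "walk (realize G h) x (map (\<lambda>\<alpha>. (fst \<alpha>, h (mate \<alpha>))) \<alpha>s) y"
  using assms by (induction \<alpha>s arbitrary: x) (auto simp: ends_realize)

text \<open>Any connected edge set contains a tree in the counting sense. An acyclic one cannot contain a
further edge, which would close a cycle with a path of that tree.\<close>

lemma spanning_tree_imp_tree_on:
  assumes "spanning_tree (realize G h) T"
  shows "T \<subseteq> edges G" "tree_on h (verts G) T"
proof -
  define K where "K = G\<lparr>edges := T\<rparr>"
  have "realize G h\<lparr>edges := T\<rparr> = realize K h" by (simp add: realize_def K_def)
  then have K: "mgraph (realize K h)" "connected_mgraph (realize K h)" "\<nexists>u p. cycle (realize K h) u p"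
    and "T \<subseteq> edges G"
    using assms by (auto simp: spanning_tree_def tree_def)
  then show "T \<subseteq> edges G" by blast
  have [simp]: "verts K = verts G" "edges K = T" by (simp_all add: K_def)
  have fin: "finite (verts G)" and V: "\<And>\<alpha>. fst \<alpha> \<in> T \<Longrightarrow> h \<alpha> \<in> verts G"
    using K(1) by (auto simp: mgraph_realize)
  have "verts G \<noteq> {}" using K(2) by (auto simp: connected_mgraph_def)
  then obtain T' where T': "T' \<subseteq> T" "tree_on h (verts G) T'"
    using cut_connected_imp_subtree[of h "verts G" T] connected_imp_cut_connected[OF K(2,1)] fin
    by auto
  have "T' = T"
  proof (rule ccontr)
    assume "T' \<noteq> T"
    then obtain e where e: "e \<in> T" "e \<notin> T'" using T'(1) by auto
    let ?x = "h (e, False)" and ?y = "h (e, True)"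
    have xy: "?x \<in> verts G" "?y \<in> verts G" using V e(1) by auto
    then obtain \<alpha>s where p: "half_path h T' ?x \<alpha>s ?y"
      using cut_connected_half_path[OF tree_onD(4)[OF T'(2)]] by metis
    let ?c = "(e, ?x) # map (\<lambda>\<alpha>. (fst \<alpha>, h (mate \<alpha>))) \<alpha>s"
    have "ends (realize K h) e = Upair ?y ?x" by (simp add: realize_def Upair_inject)
    then have "walk (realize K h) ?y ?c ?y"
      using half_path_walk[OF p, of K] T'(1) xy e by simp
    moreover have "fst ` set \<alpha>s \<subseteq> T'" using half_path_edges[OF p] .
    ultimately have "cycle (realize K h) ?y ?c"
      using half_path_distinct[OF p] e by (auto simp: cycle_def trail_def comp_def)
    then show False using K(3) by blast
  qed
  then show "tree_on h (verts G) T" using T' by simp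
qed

text \<open>This passes from a spanning tree of the graph to the tree formed by its internal edges. Since
\<open>M \<noteq> V\<close>, each vertex is still joined to another one when its turn comes.\<close>

lemma tree_on_remove_leaves:
  assumes "tree_on h V T" "T \<subseteq> E" "finite E" "finite M" "M \<subseteq> V" "M \<noteq> V"
    and "\<And>v. v \<in> M \<Longrightarrow> deg E h v = 1"
  shows "tree_on h (V - M) {e \<in> T. \<forall>i. h (e, i) \<notin> M}"
  using assms(4-)
proof (induction M rule: finite_induct)
  case empty
  then show ?case using assms(1) by simp
next
  case (insert l M)
  let ?T = "{e \<in> T. \<forall>i. h (e, i) \<notin> M}"
  have t: "tree_on h (V - M) ?T" using insert by auto
  have l: "l \<in> V - M" "V - M \<noteq> {l}" using insert by auto
  obtain \<beta> where \<beta>: "fst \<beta> \<in> ?T" "h \<beta> = l"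
    using cut_connectedD[OF tree_onD(4)[OF t], of "{l}"] l by blast
  have "card {\<alpha>. fst \<alpha> \<in> E \<and> h \<alpha> = l} = 1" using insert.prems by (simp add: deg_def)
  then obtain \<gamma> where \<gamma>: "{\<alpha>. fst \<alpha> \<in> E \<and> h \<alpha> = l} = {\<gamma>}" by (metis card_1_singletonE)
  have only: "\<alpha> = \<beta>" if "fst \<alpha> \<in> E" "h \<alpha> = l" for \<alpha>
    using eqset_imp_iff[OF \<gamma>, of \<alpha>] eqset_imp_iff[OF \<gamma>, of \<beta>] that \<beta> assms(2) by auto
  have "tree_on h (V - M - {l}) (?T - {fst \<beta>})"
    using only assms(2) by (intro tree_on_remove_leaf[OF t l(2,1) _ \<beta>]) auto
  moreover have "?T - {fst \<beta>} = {e \<in> T. \<forall>i. h (e, i) \<notin> insert l M}"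
  proof (intro equalityI subsetI)
    fix e assume e: "e \<in> ?T - {fst \<beta>}"
    have "h (e, i) \<noteq> l" for i
    proof
      assume "h (e, i) = l"
      then have "(e, i) = \<beta>" using only[of "(e, i)"] e assms(2) by auto
      then show False using e by auto
    qed
    then show "e \<in> {e \<in> T. \<forall>i. h (e, i) \<notin> insert l M}" using e by auto
  next
    fix e assume e: "e \<in> {e \<in> T. \<forall>i. h (e, i) \<notin> insert l M}"
    then have "e \<noteq> fst \<beta>" using \<beta>(2) by (metis (mono_tags, lifting) insertI1 mem_Collect_eq prod.collapse)
    then show "e \<in> ?T - {fst \<beta>}" using e by auto
  qed
  moreover have "V - M - {l} = V - insert l M" by auto
  ultimately show ?case by simp
qed


section \<open>Matching two graphs with the same degrees and external edges\<close>

lemma image_mset_eq_imp_bij_betw: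
  assumes "finite A" "finite B" "image_mset f (mset_set A) = image_mset g (mset_set B)"
  obtains \<phi> where "bij_betw \<phi> A B" "\<And>x. x \<in> A \<Longrightarrow> g (\<phi> x) = f x"
proof -
  have "\<exists>\<phi>. bij_betw \<phi> A B \<and> (\<forall>x\<in>A. g (\<phi> x) = f x)"
    using assms
  proof (induction A arbitrary: B rule: finite_induct)
    case empty
    then show ?case by (auto simp: bij_betw_def mset_set_empty_iff)
  next
    case (insert a A)
    have "f a \<in># image_mset g (mset_set B)"
      unfolding insert.prems(2)[symmetric] using insert.hyps by simp
    then obtain b where b: "b \<in> B" "g b = f a" using insert.prems(1) by auto
    define B' where "B' = B - {b}"
    have B: "B = insert b B'" "b \<notin> B'" "finite B'" using b insert.prems(1) by (auto simp: B'_def)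
    then have "image_mset f (mset_set A) = image_mset g (mset_set B')"
      using insert.prems(2) insert.hyps b(2) by simp
    then obtain \<phi> where \<phi>: "bij_betw \<phi> A B'" "\<forall>x\<in>A. g (\<phi> x) = f x" using insert.IH B by blast
    let ?\<phi> = "\<phi>(a := b)"
    have "bij_betw ?\<phi> A B'" using \<phi>(1) insert.hyps by (subst bij_betw_cong[of _ _ \<phi>]) auto
    then have "bij_betw ?\<phi> (insert a A) B"
      using notIn_Un_bij_betw[of a A ?\<phi> B'] insert.hyps B by simp
    moreover have "\<forall>x\<in>insert a A. g (?\<phi> x) = f x" using \<phi>(2) b(2) insert.hyps by auto
    ultimately show ?case by blast
  qed
  then show thesis using that by blast
qed

lemma leaf_realize:
  "finite (edges G) \<Longrightarrow> leaf (realize G h) v \<longleftrightarrow> v \<in> verts G \<and> deg (edges G) h v = 1"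
  by (simp add: leaf_def degree_realize)

lemma external_edges_realize:
  "external_edges (realize G h) = {e \<in> edges G. \<exists>i. leaf (realize G h) (h (e, i))}"
  by (auto simp: external_edges_def realize_def ex_bool_eq)

lemma ex_leaf_first_orientation:
  obtains h where "realize G h = G" "\<forall>e\<in>external_edges G. leaf G (h (e, False))"
proof -
  have "\<exists>a b. ends G e = Upair a b \<and> (e \<in> external_edges G \<longrightarrow> leaf G a)" for e
  proof -
    obtain a b where ab: "ends G e = Upair a b" by (cases "ends G e")
    then have "ends G e = Upair b a" by (simp add: Upair_inject)
    moreover have "leaf G a \<or> leaf G b" if "e \<in> external_edges G"
      using that ab by (auto simp: external_edges_def)
    ultimately show ?thesis using ab by blast
  qed
  then obtain a b where ab: "\<And>e. ends G e = Upair (a e) (b e)"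
    "\<And>e. e \<in> external_edges G \<Longrightarrow> leaf G (a e)" by metis
  let ?h = "\<lambda>\<alpha>. if snd \<alpha> then b (fst \<alpha>) else a (fst \<alpha>)"
  have "ends G = (\<lambda>e. Upair (a e) (b e))" using ab(1) by auto
  then have "realize G ?h = G" by (simp add: realize_def)
  then show thesis using that[of ?h] ab(2) by simp
qed

text \<open>Which half-edges end in leaves can thus be read off from the external edges alone, apart from
whether all vertices are leaves. An edge with two leaf ends is a connected component of its own, so
the latter happens exactly for the graph with a single edge and two vertices. The description is
what allows the leaves of two graphs to be matched through their common external edges.\<close>

lemma leaf_half_edges:
  assumes G: "mgraph G" "connected_mgraph G" "realize G h = G"
    and X: "\<forall>e\<in>external_edges G. leaf G (h (e, False))"
  shows "{\<alpha>. fst \<alpha> \<in> edges G \<and> leaf G (h \<alpha>)} =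
    {\<alpha>. fst \<alpha> \<in> external_edges G \<and> (snd \<alpha> \<longrightarrow> (\<forall>v\<in>verts G. leaf G v))}" (is "?A = ?B")
proof -
  have fin: "finite (edges G)" and V: "\<And>\<alpha>. fst \<alpha> \<in> edges G \<Longrightarrow> h \<alpha> \<in> verts G"
    using G(1) mgraph_realize[of G h] G(3) by auto
  have ext: "external_edges G = {e \<in> edges G. \<exists>i. leaf G (h (e, i))}"
    using external_edges_realize[of G h] G(3) by simp
  have cc: "cut_connected h (verts G) (edges G)"
    using connected_imp_cut_connected[of G h] G by simp
  have one: "\<alpha> = \<beta>" if "fst \<alpha> \<in> edges G" "fst \<beta> \<in> edges G" "h \<alpha> = h \<beta>" "leaf G (h \<beta>)" for \<alpha> \<beta>
  proof -
    have "card {\<gamma>. fst \<gamma> \<in> edges G \<and> h \<gamma> = h \<beta>} = 1"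
      using that(4) leaf_realize[OF fin, of h] G(3) by (simp add: deg_def)
    then obtain \<gamma> where \<gamma>: "{\<gamma>. fst \<gamma> \<in> edges G \<and> h \<gamma> = h \<beta>} = {\<gamma>}" by (metis card_1_singletonE)
    show ?thesis using eqset_imp_iff[OF \<gamma>, of \<alpha>] eqset_imp_iff[OF \<gamma>, of \<beta>] that by simp
  qed
  show ?thesis
  proof (intro equalityI subsetI)
    fix \<alpha> assume "\<alpha> \<in> ?A"
    then have \<alpha>: "fst \<alpha> \<in> edges G" "leaf G (h \<alpha>)" by auto
    have "h \<alpha> = h (fst \<alpha>, snd \<alpha>)" by simp
    then have \<alpha>X: "fst \<alpha> \<in> external_edges G" using \<alpha> ext by (metis (mono_tags, lifting) mem_Collect_eq)
    moreover have "\<forall>v\<in>verts G. leaf G v" if "snd \<alpha>"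
    proof (rule ccontr)
      assume ne: "\<not> (\<forall>v\<in>verts G. leaf G v)"
      have "mate \<alpha> = (fst \<alpha>, False)" using that by (simp add: mate_def)
      then have m: "leaf G (h (mate \<alpha>))" using X \<alpha>X by simp
      let ?L = "{h \<alpha>, h (mate \<alpha>)}"
      have L: "?L \<subseteq> verts G" "?L \<noteq> {}" using V[of \<alpha>] V[of "mate \<alpha>"] \<alpha>(1) by auto
      have "?L \<noteq> verts G" using ne \<alpha>(2) m by (metis insertE singletonD)
      from cut_connectedD[OF cc L this]
      obtain \<kappa> where \<kappa>: "fst \<kappa> \<in> edges G" "h \<kappa> \<in> ?L" "h (mate \<kappa>) \<notin> ?L" by blast
      then have "\<kappa> = \<alpha> \<or> \<kappa> = mate \<alpha>" using one[of \<kappa> \<alpha>] one[of \<kappa> "mate \<alpha>"] \<alpha> m by auto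
      then show False using \<kappa>(3) by auto
    qed
    ultimately show "\<alpha> \<in> ?B" by simp
  next
    fix \<alpha> assume "\<alpha> \<in> ?B"
    then have \<alpha>: "fst \<alpha> \<in> external_edges G" "snd \<alpha> \<Longrightarrow> \<forall>v\<in>verts G. leaf G v" by auto
    then have "fst \<alpha> \<in> edges G" by (simp add: external_edges_def)
    moreover have "leaf G (h \<alpha>)"
    proof (cases "snd \<alpha>")
      case False
      then show ?thesis using X \<alpha>(1) by (metis (full_types) prod.collapse)
    qed (use \<alpha>(2) V[OF \<open>fst \<alpha> \<in> edges G\<close>] in blast)
    ultimately show "\<alpha> \<in> ?A" by simp
  qed
qed

text \<open>Respecting mates, a permutation of half-edges is a permutation of edges together with flips;
flips are invisible in the incidence function.\<close>

lemma mate_equivariant_permutation: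
  assumes \<rho>: "\<rho> permutes {\<alpha>. fst \<alpha> \<in> P}" "\<And>\<alpha>. \<rho> (mate \<alpha>) = mate (\<rho> \<alpha>)"
  obtains \<sigma> where "\<sigma> permutes P" "\<And>\<alpha>. fst (\<rho> \<alpha>) = \<sigma> (fst \<alpha>)"
proof -
  define \<sigma> where "\<sigma> e = fst (\<rho> (e, False))" for e
  have \<sigma>: "fst (\<rho> \<alpha>) = \<sigma> (fst \<alpha>)" for \<alpha>
    using \<rho>(2)[of "(fst \<alpha>, False)"] by (cases \<alpha>; cases "snd \<alpha>") (auto simp: \<sigma>_def mate_def)
  have "\<sigma> e = e" if "e \<notin> P" for e using permutes_not_in[OF \<rho>(1)] that by (simp add: \<sigma>_def)
  moreover have "inj \<sigma>"
  proof (rule injI)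
    fix e e' assume "\<sigma> e = \<sigma> e'"
    then have "\<rho> (e, False) = \<rho> (e', False) \<or> \<rho> (e, False) = \<rho> (mate (e', False))"
      unfolding \<rho>(2) by (simp add: \<sigma>_def fst_eq_iff_mate)
    then show "e = e'" using injD[OF permutes_inj[OF \<rho>(1)]] by (auto simp: mate_def)
  qed
  moreover have "surj \<sigma>"
    using permutes_surj[OF \<rho>(1)] \<sigma> by (metis fst_conv surj_def)
  ultimately have "\<sigma> permutes P" unfolding permutes_def inj_def surj_def by metis
  then show thesis using \<sigma> that by blast
qed

lemma bij_betw_imp_inverse:
  assumes "bij_betw f A B" 
  obtains g where "bij_betw g B A" "\<And>x. x \<in> A \<Longrightarrow> g (f x) = x" "\<And>y. y \<in> B \<Longrightarrow> f (g y) = y"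
  using assms bij_betw_inv_into[OF assms] by (metis bij_betw_inv_into_left bij_betw_inv_into_right)

text \<open>Any degree-preserving bijection \<open>\<phi>\<close> maps leaves to leaves, so on the leaves it may be replaced by
the bijection that the half-edges \<open>B\<close> at leaves dictate.\<close>

lemma leaf_compatible_vertex_bijection:
  assumes V: "finite V" "finite V'" "image_mset d (mset_set V) = image_mset d' (mset_set V')"
    and leaves: "bij_betw h B {v \<in> V. d v = 1}" "bij_betw h' B {v \<in> V'. d' v = (1::nat)}"
  obtains f where "bij_betw f V V'" "\<And>v. v \<in> V \<Longrightarrow> d' (f v) = d v" "\<And>\<alpha>. \<alpha> \<in> B \<Longrightarrow> f (h \<alpha>) = h' \<alpha>"
proof -
  let ?L = "{v \<in> V. d v = 1}" and ?L' = "{v \<in> V'. d' v = 1}"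
  obtain \<phi> where \<phi>: "bij_betw \<phi> V V'" "\<And>v. v \<in> V \<Longrightarrow> d' (\<phi> v) = d v"
    using image_mset_eq_imp_bij_betw[OF V] by metis
  obtain k where k: "bij_betw k ?L B" "\<And>\<alpha>. \<alpha> \<in> B \<Longrightarrow> k (h \<alpha>) = \<alpha>"
    using bij_betw_imp_inverse[OF leaves(1)] by metis
  define f where "f = (\<lambda>v. if v \<in> ?L then h' (k v) else \<phi> v)"
  have fL: "bij_betw f ?L ?L'"
    using bij_betw_trans[OF k(1) leaves(2)] by (rule bij_betw_cong[THEN iffD1, rotated]) (simp add: f_def)
  have "\<phi> ` (V - ?L) = V' - ?L'"
  proof (intro equalityI subsetI)
    fix w assume "w \<in> \<phi> ` (V - ?L)"
    then obtain v where v: "v \<in> V" "d v \<noteq> 1" "w = \<phi> v" by auto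
    moreover have "\<phi> v \<in> V'" using bij_betw_apply[OF \<phi>(1) v(1)] .
    ultimately show "w \<in> V' - ?L'" using \<phi>(2)[OF v(1)] by simp
  next
    fix w assume w: "w \<in> V' - ?L'"
    then obtain v where v: "v \<in> V" "w = \<phi> v" using bij_betw_imp_surj_on[OF \<phi>(1)] by blast
    then have "v \<in> V - ?L" using \<phi>(2)[OF v(1)] w by simp
    then show "w \<in> \<phi> ` (V - ?L)" using v(2) by blast
  qed
  then have "bij_betw \<phi> (V - ?L) (V' - ?L')"
    by (rule bij_betw_subset[OF \<phi>(1) Diff_subset])
  then have fR: "bij_betw f (V - ?L) (V' - ?L')"
    by (rule bij_betw_cong[THEN iffD1, rotated]) (auto simp: f_def)
  have "bij_betw f (?L \<union> (V - ?L)) (?L' \<union> (V' - ?L'))"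
    using fL fR by (rule bij_betw_combine) auto
  moreover have "?L \<union> (V - ?L) = V" "?L' \<union> (V' - ?L') = V'" by auto
  ultimately have "bij_betw f V V'" by simp
  moreover have "d' (f v) = d v" if "v \<in> V" for v
  proof (cases "v \<in> ?L")
    case True
    then have "f v \<in> ?L'" using bij_betwE[OF fL] by blast
    then show ?thesis using True by simp
  next
    case False
    then have "f v = \<phi> v" unfolding f_def by (rule if_not_P)
    then show ?thesis using \<phi>(2)[OF that] by simp
  qed
  moreover have "f (h \<alpha>) = h' \<alpha>" if "\<alpha> \<in> B" for \<alpha>
  proof -
    have "f (h \<alpha>) = h' (k (h \<alpha>))"
      unfolding f_def using bij_betw_apply[OF leaves(1) that] by (rule if_P)
    then show ?thesis using k(2)[OF that] by simp
  qed
  ultimately show thesis by (rule that)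
qed

lemma edge_bijection_fixing:
  assumes "finite E" "finite E'" "card E = card E'" "card P = card P'"
    and "P \<union> X \<subseteq> E" "P' \<union> X \<subseteq> E'" "P \<inter> X = {}" "P' \<inter> X = {}"
  obtains g where "bij_betw g E E'" "g ` P = P'" "\<And>e. e \<in> X \<Longrightarrow> g e = e"
proof -
  have fin: "finite P" "finite X" "finite P'" using assms finite_subset by auto
  obtain b where b: "bij_betw b P P'" using finite_same_card_bij fin assms(4) by blast
  have "card (E - (P \<union> X)) = card (E' - (P' \<union> X))"
    using assms fin by (simp add: card_Diff_subset card_Un_disjoint)
  then obtain c where c: "bij_betw c (E - (P \<union> X)) (E' - (P' \<union> X))"
    using finite_same_card_bij assms(1,2) by (metis finite_Diff)
  define g where "g = (\<lambda>e. if e \<in> P then b e else if e \<in> X then e else c e)"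
  have gP: "bij_betw g P P'" using b by (rule bij_betw_cong[THEN iffD1, rotated]) (simp add: g_def)
  have gX: "bij_betw g X X" using bij_betw_id[of X] assms(7)
    by (elim bij_betw_cong[THEN iffD1, rotated]) (auto simp: g_def)
  have gE: "bij_betw g (E - (P \<union> X)) (E' - (P' \<union> X))"
    using c by (rule bij_betw_cong[THEN iffD1, rotated]) (simp add: g_def)
  have "bij_betw g (P \<union> X \<union> (E - (P \<union> X))) (P' \<union> X \<union> (E' - (P' \<union> X)))"
    using assms by (intro bij_betw_combine gP gX gE) auto
  moreover have "P \<union> X \<union> (E - (P \<union> X)) = E" "P' \<union> X \<union> (E' - (P' \<union> X)) = E'" using assms by auto
  moreover have "g e = e" if "e \<in> X" for e using that assms(7) by (auto simp: g_def)
  ultimately show thesis using that gP by (metis bij_betw_imp_surj_on)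
qed


lemma leaf_half_edges_bij_betw:
  assumes "finite (edges G)" "realize G h = G"
  shows "bij_betw h {\<alpha>. fst \<alpha> \<in> edges G \<and> leaf G (h \<alpha>)} {v \<in> verts G. degree G v = 1}"
proof (rule bij_betw_imageI)
  have one: "\<exists>\<gamma>. {\<alpha>. fst \<alpha> \<in> edges G \<and> h \<alpha> = v} = {\<gamma>}" if "leaf G v" for v
    using that leaf_realize[OF assms(1), of h] assms(2) by (simp add: deg_def card_1_singleton_iff)
  show "inj_on h {\<alpha>. fst \<alpha> \<in> edges G \<and> leaf G (h \<alpha>)}"
  proof (rule inj_onI)
    fix \<alpha> \<beta> assume *: "\<alpha> \<in> {\<alpha>. fst \<alpha> \<in> edges G \<and> leaf G (h \<alpha>)}"
      "\<beta> \<in> {\<alpha>. fst \<alpha> \<in> edges G \<and> leaf G (h \<alpha>)}" "h \<alpha> = h \<beta>"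
    then obtain \<gamma> where \<gamma>: "{\<kappa>. fst \<kappa> \<in> edges G \<and> h \<kappa> = h \<beta>} = {\<gamma>}" using one[of "h \<beta>"] by auto
    show "\<alpha> = \<beta>" using eqset_imp_iff[OF \<gamma>, of \<alpha>] eqset_imp_iff[OF \<gamma>, of \<beta>] * by simp
  qed
  show "h ` {\<alpha>. fst \<alpha> \<in> edges G \<and> leaf G (h \<alpha>)} = {v \<in> verts G. degree G v = 1}"
  proof (intro equalityI subsetI)
    fix v assume "v \<in> {v \<in> verts G. degree G v = 1}"
    then have v: "leaf G v" by (simp add: leaf_def)
    then obtain \<gamma> where "fst \<gamma> \<in> edges G" "h \<gamma> = v" using one[OF v] by blast
    then show "v \<in> h ` {\<alpha>. fst \<alpha> \<in> edges G \<and> leaf G (h \<alpha>)}" using v by auto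
  qed (auto simp: leaf_def)
qed

section \<open>Transformation by interchanges inside given spanning trees\<close>

text \<open>The second graph is pulled back to the vertices and edges of \<open>G\<close> as the attaching map \<open>h2\<close>, along
a bijection \<open>g\<close> of edges that matches the internal edges of the trees and a bijection of
vertices compatible with \<open>g\<close> at the leaves. Then \<open>h\<close> and \<open>h2\<close> agree at all leaves, and the
trees on the internal vertices \<open>R\<close> can be rearranged into each other. If \<open>R\<close> is empty, \<open>h\<close> and
\<open>h2\<close> agree everywhere.\<close>

lemma nni_transformation_along_trees:
  fixes G :: "('v, 'e) mgraph" and G' :: "('w, 'e) mgraph"
  assumes G: "mgraph G" "connected_mgraph G" and G': "mgraph G'" "connected_mgraph G'"
    and deg_seq: "degree_sequence G = degree_sequence G'"
    and ext: "external_edges G = external_edges G'"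
    and h: "realize G h = G" "\<forall>e\<in>external_edges G. leaf G (h (e, False))"
    and h': "realize G' h' = G'" "\<forall>e\<in>external_edges G'. leaf G' (h' (e, False))"
    and T: "T \<subseteq> edges G" "tree_on h (verts G) T"
    and T': "T' \<subseteq> edges G'" "tree_on h' (verts G') T'"
  shows "\<exists>es H f g. nni_series G es H \<and> mgraph_iso_fixing_external H G' f g \<and>
    (\<forall>e\<in>set es. e \<in> T \<inter> internal_edges G \<and> g e \<in> T' \<inter> internal_edges G')"
proof -
  let ?E = "edges G" and ?E' = "edges G'" and ?V = "verts G" and ?V' = "verts G'"
    and ?X = "external_edges G" and ?P = "T \<inter> internal_edges G" and ?P' = "T' \<inter> internal_edges G'"
  define R where "R = {v \<in> ?V. degree G v \<noteq> 1}"
  define R' where "R' = {v \<in> ?V'. degree G' v \<noteq> 1}"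
  have fin: "finite ?V" "finite ?E" "finite ?V'" "finite ?E'" using G G' by (auto simp: mgraph_def)
  have V: "h \<alpha> \<in> ?V" if "fst \<alpha> \<in> ?E" for \<alpha> using mgraph_realize[of G h] G(1) h(1) that by simp
  have V': "h' \<alpha> \<in> ?V'" if "fst \<alpha> \<in> ?E'" for \<alpha>
    using mgraph_realize[of G' h'] G'(1) h'(1) that by simp
  have d: "deg ?E h v = degree G v" for v using degree_realize[OF fin(2), of h v] h(1) by simp
  have d': "deg ?E' h' v = degree G' v" for v using degree_realize[OF fin(4), of h' v] h'(1) by simp
  have leafR: "leaf G v \<longleftrightarrow> v \<in> ?V - R" for v by (auto simp: leaf_def R_def)
  have leafR': "leaf G' v \<longleftrightarrow> v \<in> ?V' - R'" for v by (auto simp: leaf_def R'_def)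
  have all_leaf: "(\<forall>v\<in>?V. leaf G v) \<longleftrightarrow> R = {}" and all_leaf': "(\<forall>v\<in>?V'. leaf G' v) \<longleftrightarrow> R' = {}"
    by (auto simp: leaf_def R_def R'_def)
  have XE: "?X \<subseteq> ?E" "?X \<subseteq> ?E'" using ext by (auto simp: external_edges_def)

  have degs: "image_mset (degree G) (mset_set ?V) = image_mset (degree G') (mset_set ?V')"
    using deg_seq unfolding degree_sequence_def
    by (metis mset_sorted_list_of_multiset rev_is_rev_conv)
  have RR': "R = {} \<longleftrightarrow> R' = {}"
  proof -
    obtain \<phi> where \<phi>: "bij_betw \<phi> ?V ?V'" "\<And>v. v \<in> ?V \<Longrightarrow> degree G' (\<phi> v) = degree G v"
      using image_mset_eq_imp_bij_betw[OF fin(1,3) degs] by metis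
    have "?V' = \<phi> ` ?V" using \<phi>(1) by (simp add: bij_betw_def)
    then show ?thesis using \<phi>(2) by (auto simp: R_def R'_def)
  qed
  \<comment> \<open>the half-edges ending in leaves are literally the same in both graphs\<close>
  define B where "B = {\<alpha>. fst \<alpha> \<in> ?E \<and> leaf G (h \<alpha>)}"
  have BX: "fst \<alpha> \<in> ?X" if "\<alpha> \<in> B" for \<alpha>
    using that leaf_half_edges[OF G h] by (auto simp: B_def)
  have "B = {\<alpha>. fst \<alpha> \<in> ?X \<and> (snd \<alpha> \<longrightarrow> R = {})}"
    unfolding B_def leaf_half_edges[OF G h] using all_leaf by simp
  also have "\<dots> = {\<alpha>. fst \<alpha> \<in> external_edges G' \<and> (snd \<alpha> \<longrightarrow> R' = {})}" using RR' ext by simp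
  also have "\<dots> = {\<alpha>. fst \<alpha> \<in> ?E' \<and> leaf G' (h' \<alpha>)}"
    unfolding leaf_half_edges[OF G' h'] using all_leaf' by simp
  finally have B': "B = {\<alpha>. fst \<alpha> \<in> ?E' \<and> leaf G' (h' \<alpha>)}" .
  obtain f where f: "bij_betw f ?V ?V'" "\<And>v. v \<in> ?V \<Longrightarrow> degree G' (f v) = degree G v"
    "\<And>\<alpha>. \<alpha> \<in> B \<Longrightarrow> f (h \<alpha>) = h' \<alpha>"
    using leaf_compatible_vertex_bijection[OF fin(1,3) degs, of h B h']
      leaf_half_edges_bij_betw[OF fin(2) h(1)] leaf_half_edges_bij_betw[OF fin(4) h'(1)]
    unfolding B_def[symmetric] B'[symmetric] by metis
  obtain k where k: "bij_betw k ?V' ?V" "\<And>v. v \<in> ?V \<Longrightarrow> k (f v) = v" "\<And>w. w \<in> ?V' \<Longrightarrow> f (k w) = w"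
    using bij_betw_imp_inverse[OF f(1)] by metis
  have fR: "f ` R = R'"
  proof -
    have "?V' = f ` ?V" using f(1) by (simp add: bij_betw_def)
    then show ?thesis using f(2) by (auto simp: R_def R'_def)
  qed
  have "R \<subseteq> ?V" by (auto simp: R_def)
  then have kR: "k ` R' = R" unfolding fR[symmetric] image_image using k(2) by (auto simp: subset_iff)

  have internal: "?P = {e \<in> T. \<forall>i. h (e, i) \<notin> ?V - R}" "?P' = {e \<in> T'. \<forall>i. h' (e, i) \<notin> ?V' - R'}"
    using T(1) T'(1) external_edges_realize[of G h] external_edges_realize[of G' h'] h(1) h'(1)
    by (auto simp: internal_edges_def leafR leafR')
  have tree: "tree_on h R ?P" if "R \<noteq> {}"
  proof -
    have "tree_on h (?V - (?V - R)) {e \<in> T. \<forall>i. h (e, i) \<notin> ?V - R}"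
      using T fin that \<open>R \<subseteq> ?V\<close> by (intro tree_on_remove_leaves[where E = ?E]) (auto simp: d R_def)
    then show ?thesis using internal(1) double_diff[OF \<open>R \<subseteq> ?V\<close>] by simp
  qed
  have tree': "tree_on h' R' ?P'" if "R' \<noteq> {}"
  proof -
    have "R' \<subseteq> ?V'" by (auto simp: R'_def)
    have "tree_on h' (?V' - (?V' - R')) {e \<in> T'. \<forall>i. h' (e, i) \<notin> ?V' - R'}"
      using T' fin that \<open>R' \<subseteq> ?V'\<close>
      by (intro tree_on_remove_leaves[where E = ?E']) (auto simp: d' R'_def)
    then show ?thesis using internal(2) double_diff[OF \<open>R' \<subseteq> ?V'\<close>] by simp
  qed
  have PP: "card ?P = card ?P'"
  proof (cases "R = {}")
    case True
    then have "?P = {}" "?P' = {}" using V V' T(1) T'(1) RR' by (auto simp: internal)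
    then show ?thesis by simp
  next
    case False
    have "card R = card R'" using fR f(1) \<open>R \<subseteq> ?V\<close>
      by (metis bij_betw_def card_image inj_on_subset)
    then show ?thesis using tree_onD(5)[OF tree] tree_onD(5)[OF tree'] False RR' by simp
  qed
  have "2 * card ?E = 2 * card ?E'"
  proof -
    have "2 * card ?E = (\<Sum>v\<in>?V. degree G' (f v))"
      using handshake[OF fin(2,1), of h] V f(2) by (simp add: d)
    also have "\<dots> = (\<Sum>v\<in>?V'. degree G' v)" using sum.reindex_bij_betw[OF f(1)] .
    also have "\<dots> = 2 * card ?E'" using handshake[OF fin(4,3), of h'] V' by (simp add: d')
    finally show ?thesis .
  qed
  then have EE: "card ?E = card ?E'" by simp
  obtain g where g: "bij_betw g ?E ?E'" "g ` ?P = ?P'" "\<And>e. e \<in> ?X \<Longrightarrow> g e = e"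
    using edge_bijection_fixing[OF fin(2,4) EE PP, of ?X] XE T(1) T'(1) ext
    by (auto simp: internal_edges_def)
  have gE: "g e \<in> ?E'" if "e \<in> ?E" for e using bij_betwE[OF g(1)] that by blast

  define \<rho>\<^sub>g where "\<rho>\<^sub>g = (\<lambda>\<alpha> :: 'e \<times> bool. (g (fst \<alpha>), snd \<alpha>))"
  define h2 where "h2 = k \<circ> h' \<circ> \<rho>\<^sub>g"
  have f_h2: "f (h2 \<alpha>) = h' (\<rho>\<^sub>g \<alpha>)" if "fst \<alpha> \<in> ?E" for \<alpha>
    using V'[of "\<rho>\<^sub>g \<alpha>"] k(3) gE[OF that] by (simp add: h2_def \<rho>\<^sub>g_def)
  have \<rho>g_image: "\<rho>\<^sub>g ` {\<alpha>. fst \<alpha> \<in> D} = {\<alpha>. fst \<alpha> \<in> g ` D}" for D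
  proof (intro equalityI subsetI)
    fix \<beta> :: "'e \<times> bool" assume "\<beta> \<in> {\<alpha>. fst \<alpha> \<in> g ` D}"
    then obtain e where "e \<in> D" "\<beta> = \<rho>\<^sub>g (e, snd \<beta>)" by (auto simp: \<rho>\<^sub>g_def prod_eq_iff)
    then show "\<beta> \<in> \<rho>\<^sub>g ` {\<alpha>. fst \<alpha> \<in> D}" by (metis fst_conv imageI mem_Collect_eq)
  qed (auto simp: \<rho>\<^sub>g_def)
  have \<rho>g_bij: "bij_betw \<rho>\<^sub>g {\<alpha>. fst \<alpha> \<in> ?E} {\<alpha>. fst \<alpha> \<in> ?E'}"
  proof (rule bij_betw_imageI)
    show "inj_on \<rho>\<^sub>g {\<alpha>. fst \<alpha> \<in> ?E}"
      using bij_betw_imp_inj_on[OF g(1)] by (auto simp: inj_on_def \<rho>\<^sub>g_def)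
    show "\<rho>\<^sub>g ` {\<alpha>. fst \<alpha> \<in> ?E} = {\<alpha>. fst \<alpha> \<in> ?E'}"
      using \<rho>g_image[of ?E] bij_betw_imp_surj_on[OF g(1)] by simp
  qed
  have deg2: "deg ?E h v = deg ?E h2 v" if "v \<in> ?V" for v
  proof -
    have "f v \<in> ?V'" using f(1) that by (auto dest: bij_betwE)
    then have "deg ?E h2 (k (f v)) = deg ?E' h' (f v)"
      unfolding h2_def using deg_transport[OF \<rho>g_bij bij_betw_imp_inj_on[OF k(1)], of h'] V' by blast
    then show ?thesis using k(2)[OF that] f(2)[OF that] by (simp add: d d')
  qed
  have agree: "h \<alpha> = h2 \<alpha> \<or> h \<alpha> \<in> R \<and> h2 \<alpha> \<in> R" if \<alpha>: "fst \<alpha> \<in> ?E" for \<alpha>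
  proof (cases "\<alpha> \<in> B")
    case True
    then have "\<rho>\<^sub>g \<alpha> = \<alpha>" using BX g(3) by (simp add: \<rho>\<^sub>g_def)
    then have "f (h2 \<alpha>) = f (h \<alpha>)" using f_h2[OF \<alpha>] f(3)[OF True] by simp
    moreover have "h2 \<alpha> = k (h' \<alpha>)" using \<open>\<rho>\<^sub>g \<alpha> = \<alpha>\<close> by (simp add: h2_def)
    ultimately show ?thesis using k(2)[OF V[OF \<alpha>]] f(3)[OF True] by simp
  next
    case False
    have \<rho>E: "fst (\<rho>\<^sub>g \<alpha>) \<in> ?E'" using gE \<alpha> by (simp add: \<rho>\<^sub>g_def)
    have "\<rho>\<^sub>g \<alpha> \<notin> B"
    proof
      assume \<rho>B: "\<rho>\<^sub>g \<alpha> \<in> B"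
      then have "g (fst \<alpha>) \<in> ?X" using BX[OF \<rho>B] by (simp add: \<rho>\<^sub>g_def)
      then have "g (fst \<alpha>) = fst \<alpha>"
        using g(3) XE(1) \<alpha> bij_betw_imp_inj_on[OF g(1)] by (auto dest: inj_onD)
      then show False using \<rho>B False by (simp add: \<rho>\<^sub>g_def)
    qed
    then have "h' (\<rho>\<^sub>g \<alpha>) \<in> R'" using \<rho>E V'[OF \<rho>E] by (auto simp: B' leafR')
    then have "h2 \<alpha> \<in> R" using kR by (auto simp: h2_def)
    moreover have "h \<alpha> \<in> R" using False \<alpha> V[OF \<alpha>] by (auto simp: B_def leafR)
    ultimately show ?thesis by simp
  qed
  have "\<exists>h1 \<rho>. (exchange ?E ?P)\<^sup>*\<^sup>* h h1 \<and> \<rho> permutes {\<alpha>. fst \<alpha> \<in> ?P} \<and>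
    (\<forall>\<alpha>. \<rho> (mate \<alpha>) = mate (\<rho> \<alpha>)) \<and> (\<forall>\<alpha>. fst \<alpha> \<in> ?E \<longrightarrow> h1 \<alpha> = h2 (\<rho> \<alpha>)) \<and>
    (\<forall>v. deg ?E h1 v = deg ?E h v) \<and> (\<forall>\<alpha>. h1 \<alpha> = h \<alpha> \<or> h1 \<alpha> \<in> R)"
  proof (cases "R = {}")
    case True
    then show ?thesis using agree by (intro exI[of _ h] exI[of _ id]) (auto simp: permutes_id)
  next
    case False
    have "tree_on h2 (k ` R') ?P"
      unfolding h2_def
    proof (rule tree_on_transport[OF tree'])
      show "R' \<noteq> {}" using False RR' by simp
      show "\<rho>\<^sub>g (mate \<alpha>) = mate (\<rho>\<^sub>g \<alpha>)" for \<alpha> by (simp add: \<rho>\<^sub>g_def mate_def)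
      show "\<rho>\<^sub>g ` {\<alpha>. fst \<alpha> \<in> ?P} = {\<alpha>. fst \<alpha> \<in> ?P'}"
        using \<rho>g_image[of ?P] unfolding g(2) .
      show "inj_on k R'" using bij_betw_imp_inj_on[OF k(1)] by (rule inj_on_subset) (auto simp: R'_def)
    qed (use PP T(1) fin(2) finite_subset in auto)
    then obtain h1 \<rho> where 1: "(exchange ?E ?P)\<^sup>*\<^sup>* h h1" "\<rho> permutes {\<alpha>. fst \<alpha> \<in> ?P}"
      "\<forall>\<alpha>. \<rho> (mate \<alpha>) = mate (\<rho> \<alpha>)" "\<forall>\<alpha>. fst \<alpha> \<in> ?E \<longrightarrow> h1 \<alpha> = h2 (\<rho> \<alpha>)"
      using tree_rearrangement[OF tree[OF False] _ fin(2) _ agree deg2] T(1) \<open>R \<subseteq> ?V\<close>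
      unfolding kR by blast
    then show ?thesis using exchanges_invariant[OF 1(1) tree[OF False]] by metis
  qed
  then obtain h1 \<rho> where h1: "(exchange ?E ?P)\<^sup>*\<^sup>* h h1" "\<And>\<alpha>. fst \<alpha> \<in> ?E \<Longrightarrow> h1 \<alpha> = h2 (\<rho> \<alpha>)"
    "\<And>v. deg ?E h1 v = deg ?E h v" "\<And>\<alpha>. h1 \<alpha> = h \<alpha> \<or> h1 \<alpha> \<in> R"
    and \<rho>: "\<rho> permutes {\<alpha>. fst \<alpha> \<in> ?P}" "\<And>\<alpha>. \<rho> (mate \<alpha>) = mate (\<rho> \<alpha>)" by metis
  obtain \<sigma> where \<sigma>: "\<sigma> permutes ?P" "\<And>\<alpha>. fst (\<rho> \<alpha>) = \<sigma> (fst \<alpha>)"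
    using mate_equivariant_permutation[OF \<rho>] by metis
  define H where "H = realize G h1"
  have "?P \<subseteq> ?E" using T(1) by auto
  then obtain es where es: "set es \<subseteq> ?P" "nni_series G es H"
    using nni_series_of_exchanges[OF h1(1) _ V] h(1) by (auto simp: H_def)
  have \<sigma>E: "\<sigma> permutes ?E" using \<sigma>(1) \<open>?P \<subseteq> ?E\<close> by (rule permutes_subset)
  have "mgraph_iso H G' f (g \<circ> \<sigma>)"
    unfolding mgraph_iso_def
  proof (intro conjI ballI)
    show "bij_betw f (verts H) ?V'" using f(1) by (simp add: H_def)
    show "bij_betw (g \<circ> \<sigma>) (edges H) ?E'"
      using bij_betw_trans[OF permutes_imp_bij[OF \<sigma>E] g(1)] by (simp add: H_def)
    fix e assume "e \<in> edges H"
    then have e: "e \<in> ?E" by (simp add: H_def)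
    let ?\<alpha> = "(e, False)"
    have \<rho>E: "fst (\<rho> \<alpha>) \<in> ?E" if "fst \<alpha> \<in> ?E" for \<alpha>
      using that \<sigma>(2) permutes_in_image[OF \<sigma>E] by simp
    have "f (h1 \<alpha>) = h' (\<rho>\<^sub>g (\<rho> \<alpha>))" if "fst \<alpha> \<in> ?E" for \<alpha>
      using h1(2)[OF that] f_h2[OF \<rho>E[OF that]] by simp
    then have "map_uprod f (ends H e) = Upair (h' (\<rho>\<^sub>g (\<rho> ?\<alpha>))) (h' (\<rho>\<^sub>g (\<rho> (mate ?\<alpha>))))"
      using ends_realize[of G h1 ?\<alpha>] e by (simp add: H_def)
    also have "\<rho>\<^sub>g (\<rho> (mate ?\<alpha>)) = mate (\<rho>\<^sub>g (\<rho> ?\<alpha>))" by (simp add: \<rho>(2)) (simp add: \<rho>\<^sub>g_def mate_def)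
    also have "Upair (h' (\<rho>\<^sub>g (\<rho> ?\<alpha>))) (h' (mate (\<rho>\<^sub>g (\<rho> ?\<alpha>)))) = ends G' (fst (\<rho>\<^sub>g (\<rho> ?\<alpha>)))"
      using ends_realize[of G' h'] h'(1) by simp
    also have "fst (\<rho>\<^sub>g (\<rho> ?\<alpha>)) = (g \<circ> \<sigma>) e" using \<sigma>(2) by (simp add: \<rho>\<^sub>g_def)
    finally show "ends G' ((g \<circ> \<sigma>) e) = map_uprod f (ends H e)" by simp
  qed
  moreover have "(g \<circ> \<sigma>) e = e" if eX: "e \<in> external_edges H" for e
  proof -
    obtain i where e: "e \<in> ?E" "leaf H (h1 (e, i))"
      using eX unfolding H_def external_edges_realize by blast
    then have "leaf G (h1 (e, i))"
      using leaf_realize[OF fin(2), of h1] leaf_realize[OF fin(2), of h] h(1) h1(3) by (simp add: H_def)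
    then have "leaf G (h (e, i))" using h1(4)[of "(e, i)"] leafR by auto
    then have "e \<in> ?X" using e(1) external_edges_realize[of G h] h(1) by auto
    moreover from this have "\<sigma> e = e"
      using permutes_not_in[OF \<sigma>(1)] by (auto simp: internal_edges_def)
    ultimately show ?thesis using g(3) by simp
  qed
  moreover have "(g \<circ> \<sigma>) e \<in> ?P'" if "e \<in> ?P" for e
    using that permutes_in_image[OF \<sigma>(1), of e] g(2) by auto
  ultimately show ?thesis
    using es unfolding mgraph_iso_fixing_external_def by blast
qed

theorem theorem1:
  fixes G :: "('v, 'e) mgraph" and G' :: "('w, 'e) mgraph"
  assumes "mgraph G" and "connected_mgraph G"
    and "mgraph G'" and "connected_mgraph G'"
    and "degree_sequence G = degree_sequence G'"
    and "external_edges G = external_edges G'"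
  shows "(\<exists>es H f g. nni_series G es H \<and> mgraph_iso_fixing_external H G' f g) \<and>
    (\<forall>T T'. spanning_tree G T \<longrightarrow> spanning_tree G' T' \<longrightarrow>
      (\<exists>es H f g. nni_series G es H \<and> mgraph_iso_fixing_external H G' f g \<and>
        (\<forall>e\<in>set es. e \<in> T \<inter> internal_edges G \<and> g e \<in> T' \<inter> internal_edges G')))"
proof -
  obtain h where h: "realize G h = G" "\<forall>e\<in>external_edges G. leaf G (h (e, False))"
    using ex_leaf_first_orientation[of G] by metis
  obtain h' where h': "realize G' h' = G'" "\<forall>e\<in>external_edges G'. leaf G' (h' (e, False))"
    using ex_leaf_first_orientation[of G'] by metis
  note main = nni_transformation_along_trees[OF assms h h']
  have cut: "cut_connected h (verts G) (edges G)" "cut_connected h' (verts G') (edges G')"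
    using connected_imp_cut_connected[of G h] connected_imp_cut_connected[of G' h'] assms h(1) h'(1)
    by simp_all
  have "finite (verts G)" "verts G \<noteq> {}" "finite (verts G')" "verts G' \<noteq> {}"
    using assms by (auto simp: mgraph_def connected_mgraph_def)
  then obtain T T' where "T \<subseteq> edges G" "tree_on h (verts G) T" "T' \<subseteq> edges G'" "tree_on h' (verts G') T'"
    using cut_connected_imp_subtree[OF cut(1)] cut_connected_imp_subtree[OF cut(2)] by metis
  from main[OF this] have "\<exists>es H f g. nni_series G es H \<and> mgraph_iso_fixing_external H G' f g" by blast
  moreover have "\<exists>es H f g. nni_series G es H \<and> mgraph_iso_fixing_external H G' f g \<and>
        (\<forall>e\<in>set es. e \<in> T \<inter> internal_edges G \<and> g e \<in> T' \<inter> internal_edges G')"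
    if "spanning_tree G T" "spanning_tree G' T'" for T T'
    using main spanning_tree_imp_tree_on[of G h T] spanning_tree_imp_tree_on[of G' h' T'] that
    unfolding h(1) h'(1) by blast
  ultimately show ?thesis by blast
qed

end
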